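(* Let $\alpha>1$ be a constant, let $(M^m,g)$ be a compact Riemannian manifold, let $(N^n,h)$ be a Riemannian manifold, and let $\psi:(M,g)\to(N,h)$ be a smooth map. Then $$(\mathrm{div}\,S_{\alpha}(\psi))(Y)=-h(\tau_{\alpha}(\psi),d\psi(Y))$$ for all smooth vector fields $Y$ on $M$.
   Context: $|d\psi|$ denotes the Hilbert–Schmidt norm of $d\psi$ with respect to $g$ and $h$. $\nabla$ denotes the connection on $\psi^{-1}TN$ induced from the Levi-Civita connection of $N$, and $\tau(\psi)=\mathrm{Tr}_g\nabla d\psi$ is the tension field. The $\alpha$-tension field is $$\tau_\alpha(\psi)=2\alpha(1+|d\psi|^2)^{\alpha-1}\tau(\psi)+d\psi\big(\mathrm{grad}(2\alpha(1+|d\psi|^2)^{\alpha-1})\big)\in\Gamma(\psi^{-1}TN).$$ The $\alpha$-stress energy tensor of $\psi$ is the symmetric 2-tensor on $M$ $$S_\alpha(\psi)=(1+|d\psi|^2)^{\alpha}g-2\alpha(1+|d\psi|^2)^{\alpha-1}\psi^{*}h.$$ The divergence of a symmetric 2-tensor $S$ on $M$ is $(\mathrm{div}\,S)(Y)=\sum_{i=1}^m(\nabla_{e_i}S)(e_i,Y)$ for a local orthonormal frame $\{e_i\}$ of $(M,g)$. *)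

theory Defs
  imports "HOL-Analysis.Analysis"
begin

section \<open>Smooth maps between open subsets of Euclidean spaces\<close>

text \<open>Intended for open \<open>S\<close> in a finite-dimensional domain, where it means that all iterated
  directional derivatives exist as Frechet derivatives of continuous functions.\<close>

primrec Ck_on :: "nat \<Rightarrow> 'a::real_normed_vector set \<Rightarrow> ('a \<Rightarrow> 'b::real_normed_vector) \<Rightarrow> bool" where
  "Ck_on 0 S f \<longleftrightarrow> continuous_on S f"
| "Ck_on (Suc k) S f \<longleftrightarrow>
     (\<forall>x\<in>S. f differentiable (at x)) \<and> (\<forall>v. Ck_on k S (\<lambda>x. frechet_derivative f (at x) v))"

definition smooth_on :: "'a::real_normed_vector set \<Rightarrow> ('a \<Rightarrow> 'b::real_normed_vector) \<Rightarrow> bool" where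
  "smooth_on S f \<longleftrightarrow> (\<forall>k. Ck_on k S f)"


section \<open>Smooth manifolds\<close>

text \<open>A chart is a pair of its domain and its coordinate map. The atlas need not be maximal.\<close>

type_synonym ('a, 'm) chart = "'a set \<times> ('a \<Rightarrow> real ^ 'm)"

record ('a, 'm) mfd =
  mtop :: "'a topology"
  atlas :: "('a, 'm) chart set"

abbreviation points :: "('a, 'm) mfd \<Rightarrow> 'a set" where
  "points M \<equiv> topspace (mtop M)"

definition cinv :: "('a, 'm) chart \<Rightarrow> real ^ 'm \<Rightarrow> 'a" where
  "cinv c = inv_into (fst c) (snd c)"

definition smooth_manifold :: "('a, 'm::finite) mfd \<Rightarrow> bool" where
  "smooth_manifold M \<longleftrightarrow>
     Hausdorff_space (mtop M) \<and> second_countable (mtop M) \<and>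
     (\<Union>c\<in>atlas M. fst c) = points M \<and>
     (\<forall>c\<in>atlas M. openin (mtop M) (fst c) \<and> open (snd c ` fst c) \<and>
        homeomorphic_map (subtopology (mtop M) (fst c)) (top_of_set (snd c ` fst c)) (snd c)) \<and>
     (\<forall>c\<in>atlas M. \<forall>d\<in>atlas M. smooth_on (snd c ` (fst c \<inter> fst d)) (snd d \<circ> cinv c))"

definition smooth_map ::
    "('a, 'm::finite) mfd \<Rightarrow> ('b, 'n::finite) mfd \<Rightarrow> ('a \<Rightarrow> 'b) \<Rightarrow> bool" where
  "smooth_map M N \<psi> \<longleftrightarrow>
     continuous_map (mtop M) (mtop N) \<psi> \<and>
     (\<forall>c\<in>atlas M. \<forall>d\<in>atlas N.
        smooth_on (snd c ` (fst c \<inter> \<psi> -` fst d)) (snd d \<circ> \<psi> \<circ> cinv c))"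

definition smooth_fun :: "('a, 'm::finite) mfd \<Rightarrow> 'a set \<Rightarrow> ('a \<Rightarrow> real) \<Rightarrow> bool" where
  "smooth_fun M U f \<longleftrightarrow> (\<forall>c\<in>atlas M. smooth_on (snd c ` (fst c \<inter> U)) (f \<circ> cinv c))"


section \<open>Tangent vectors and differentials\<close>

text \<open>The tangent space at \<open>p\<close> is modelled by \<open>real ^ 'm\<close>: a tangent vector is given by its
  components in one chart selected for each point \<open>p\<close> by \<open>chart_at M p\<close>. Consequently a vector
  field is not smooth as a function into \<open>real ^ 'm\<close>, but when its components in each single
  chart of the atlas are (\<open>smooth_section\<close> below).\<close>

definition chart_at :: "('a, 'm) mfd \<Rightarrow> 'a \<Rightarrow> ('a, 'm) chart" where
  "chart_at M p = (SOME c. c \<in> atlas M \<and> p \<in> fst c)"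

definition differential ::
    "('a, 'm::finite) mfd \<Rightarrow> ('a \<Rightarrow> 'v::real_normed_vector) \<Rightarrow> 'a \<Rightarrow> real ^ 'm \<Rightarrow> 'v" where
  "differential M f p =
     frechet_derivative (f \<circ> cinv (chart_at M p)) (at (snd (chart_at M p) p))"

definition tangent_map ::
    "('a, 'm::finite) mfd \<Rightarrow> ('b, 'n::finite) mfd \<Rightarrow> ('a \<Rightarrow> 'b) \<Rightarrow> 'a \<Rightarrow> real ^ 'm \<Rightarrow> real ^ 'n" where
  "tangent_map M N \<psi> p = differential M (snd (chart_at N (\<psi> p)) \<circ> \<psi>) p"

text \<open>Sections over \<open>U\<close> of the pull-back bundle \<open>\<psi>\<^sup>-\<^sup>1TN\<close>: here \<open>W q\<close> is a tangent vector of \<open>N\<close>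
  at \<open>\<psi> q\<close>, and \<open>differential N (snd d) (\<psi> q) (W q)\<close> are its components in the chart \<open>d\<close>.
  Vector fields on \<open>M\<close> are the sections along the identity.\<close>

definition smooth_section ::
    "('a, 'm::finite) mfd \<Rightarrow> ('b, 'n::finite) mfd \<Rightarrow> ('a \<Rightarrow> 'b) \<Rightarrow> 'a set \<Rightarrow> ('a \<Rightarrow> real ^ 'n) \<Rightarrow> bool" where
  "smooth_section M N \<psi> U W \<longleftrightarrow>
     (\<forall>c\<in>atlas M. \<forall>d\<in>atlas N.
        smooth_on (snd c ` (fst c \<inter> U \<inter> \<psi> -` fst d))
          ((\<lambda>q. differential N (snd d) (\<psi> q) (W q)) \<circ> cinv c))"

abbreviation smooth_vector_field ::
    "('a, 'm::finite) mfd \<Rightarrow> 'a set \<Rightarrow> ('a \<Rightarrow> real ^ 'm) \<Rightarrow> bool" where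
  "smooth_vector_field M \<equiv> smooth_section M M (\<lambda>q. q)"


section \<open>Riemannian metrics\<close>

type_synonym ('a, 'm) tensor2 = "'a \<Rightarrow> real ^ 'm \<Rightarrow> real ^ 'm \<Rightarrow> real"

definition riemannian_metric :: "('a, 'm::finite) mfd \<Rightarrow> ('a, 'm) tensor2 \<Rightarrow> bool" where
  "riemannian_metric M g \<longleftrightarrow>
     (\<forall>p\<in>points M. bilinear (g p) \<and> (\<forall>u v. g p u v = g p v u) \<and> (\<forall>v. v \<noteq> 0 \<longrightarrow> g p v v > 0)) \<and>
     (\<forall>U X Y. openin (mtop M) U \<longrightarrow> smooth_vector_field M U X \<longrightarrow> smooth_vector_field M U Y \<longrightarrow>
        smooth_fun M U (\<lambda>q. g q (X q) (Y q)))"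

definition riemannian_manifold :: "('a, 'm::finite) mfd \<Rightarrow> ('a, 'm) tensor2 \<Rightarrow> bool" where
  "riemannian_manifold M g \<longleftrightarrow> smooth_manifold M \<and> riemannian_metric M g"

definition local_orthonormal_frame ::
    "('a, 'm::finite) mfd \<Rightarrow> ('a, 'm) tensor2 \<Rightarrow> 'a set \<Rightarrow> ('m \<Rightarrow> 'a \<Rightarrow> real ^ 'm) \<Rightarrow> bool" where
  "local_orthonormal_frame M g U e \<longleftrightarrow>
     openin (mtop M) U \<and> (\<forall>i. smooth_vector_field M U (e i)) \<and>
     (\<forall>q\<in>U. \<forall>i j. g q (e i q) (e j q) = (if i = j then 1 else 0))"

text \<open>Some smooth orthonormal frame defined on an open neighbourhood of \<open>p\<close>; the traces below do
  not depend on the choice.\<close>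

definition frame_at ::
    "('a, 'm::finite) mfd \<Rightarrow> ('a, 'm) tensor2 \<Rightarrow> 'a \<Rightarrow> 'm \<Rightarrow> 'a \<Rightarrow> real ^ 'm" where
  "frame_at M g p = (SOME e. \<exists>U. p \<in> U \<and> local_orthonormal_frame M g U e)"

definition gradient ::
    "('a, 'm::finite) mfd \<Rightarrow> ('a, 'm) tensor2 \<Rightarrow> ('a \<Rightarrow> real) \<Rightarrow> 'a \<Rightarrow> real ^ 'm" where
  "gradient M g f p = (THE w. \<forall>v. g p w v = differential M f p v)"


section \<open>Connections\<close>

text \<open>A connection on \<open>\<psi>\<^sup>-\<^sup>1TN\<close>, where \<open>D W p v\<close> is the derivative at \<open>p\<close> of the section \<open>W\<close> in
  direction \<open>v\<close>. It acts on sections over arbitrary open sets; the fourth clause says that it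
  commutes with restriction, so that \<open>D W p\<close> depends only on the germ of \<open>W\<close> at \<open>p\<close>.\<close>

type_synonym ('a, 'm, 'n) conn = "('a \<Rightarrow> real ^ 'n) \<Rightarrow> 'a \<Rightarrow> real ^ 'm \<Rightarrow> real ^ 'n"

definition connection_along ::
    "('a, 'm::finite) mfd \<Rightarrow> ('b, 'n::finite) mfd \<Rightarrow> ('a \<Rightarrow> 'b) \<Rightarrow> ('a, 'm, 'n) conn \<Rightarrow> bool" where
  "connection_along M N \<psi> D \<longleftrightarrow>
     (\<forall>U W. openin (mtop M) U \<longrightarrow> smooth_section M N \<psi> U W \<longrightarrow>
        (\<forall>p\<in>U. linear (D W p)) \<and>
        (\<forall>W'. smooth_section M N \<psi> U W' \<longrightarrow>
           (\<forall>p\<in>U. \<forall>v. D (\<lambda>q. W q + W' q) p v = D W p v + D W' p v)) \<and>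
        (\<forall>f. smooth_fun M U f \<longrightarrow>
           (\<forall>p\<in>U. \<forall>v. D (\<lambda>q. f q *\<^sub>R W q) p v = differential M f p v *\<^sub>R W p + f p *\<^sub>R D W p v)) \<and>
        (\<forall>W'. (\<forall>q\<in>U. W q = W' q) \<longrightarrow> (\<forall>p\<in>U. D W p = D W' p)) \<and>
        (\<forall>X. smooth_vector_field M U X \<longrightarrow> smooth_section M N \<psi> U (\<lambda>q. D W q (X q))))"

abbreviation affine_connection ::
    "('a, 'm::finite) mfd \<Rightarrow> ('a, 'm, 'm) conn \<Rightarrow> bool" where
  "affine_connection M \<equiv> connection_along M M (\<lambda>q. q)"

text \<open>\<open>\<nabla>\<^sub>XY - \<nabla>\<^sub>YX = [X, Y]\<close>, with both sides regarded as derivations: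
  \<open>[X, Y] f = X (Y f) - Y (X f)\<close>.\<close>

definition torsion_free :: "('a, 'm::finite) mfd \<Rightarrow> ('a, 'm, 'm) conn \<Rightarrow> bool" where
  "torsion_free M nabla \<longleftrightarrow>
     (\<forall>U X Y f. openin (mtop M) U \<longrightarrow> smooth_vector_field M U X \<longrightarrow> smooth_vector_field M U Y \<longrightarrow>
        smooth_fun M U f \<longrightarrow>
        (\<forall>p\<in>U. differential M f p (nabla Y p (X p) - nabla X p (Y p)) =
           differential M (\<lambda>q. differential M f q (Y q)) p (X p) -
           differential M (\<lambda>q. differential M f q (X q)) p (Y p)))"

definition metric_compatible ::
    "('a, 'm::finite) mfd \<Rightarrow> ('a, 'm) tensor2 \<Rightarrow> ('a, 'm, 'm) conn \<Rightarrow> bool" where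
  "metric_compatible M g nabla \<longleftrightarrow>
     (\<forall>U Y Z. openin (mtop M) U \<longrightarrow> smooth_vector_field M U Y \<longrightarrow> smooth_vector_field M U Z \<longrightarrow>
        (\<forall>p\<in>U. \<forall>v. differential M (\<lambda>q. g q (Y q) (Z q)) p v =
           g p (nabla Y p v) (Z p) + g p (Y p) (nabla Z p v)))"

definition levi_civita ::
    "('a, 'm::finite) mfd \<Rightarrow> ('a, 'm) tensor2 \<Rightarrow> ('a, 'm, 'm) conn \<Rightarrow> bool" where
  "levi_civita M g nabla \<longleftrightarrow>
     affine_connection M nabla \<and> torsion_free M nabla \<and> metric_compatible M g nabla"

text \<open>The connection on \<open>\<psi>\<^sup>-\<^sup>1TN\<close> induced by a connection \<open>nabla\<close> on \<open>TN\<close> is characterised by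
  differentiating the section \<open>Z \<circ> \<psi>\<close> in direction \<open>v\<close> as \<open>Z\<close> in direction \<open>d\<psi>(v)\<close>, for all local vector
  fields \<open>Z\<close> on \<open>N\<close>.\<close>

definition induced_connection ::
    "('a, 'm::finite) mfd \<Rightarrow> ('b, 'n::finite) mfd \<Rightarrow> ('a \<Rightarrow> 'b) \<Rightarrow> ('b, 'n, 'n) conn \<Rightarrow>
     ('a, 'm, 'n) conn \<Rightarrow> bool" where
  "induced_connection M N \<psi> nabla D \<longleftrightarrow>
     connection_along M N \<psi> D \<and>
     (\<forall>V Z. openin (mtop N) V \<longrightarrow> smooth_vector_field N V Z \<longrightarrow>
        (\<forall>p\<in>points M. \<psi> p \<in> V \<longrightarrow>
           (\<forall>v. D (\<lambda>q. Z (\<psi> q)) p v = nabla Z (\<psi> p) (tangent_map M N \<psi> p v))))"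


section \<open>Divergence of a 2-tensor\<close>

text \<open>\<open>(\<nabla>\<^sub>XS)(V, W)\<close>\<close>

definition cov_deriv2 ::
    "('a, 'm::finite) mfd \<Rightarrow> ('a, 'm, 'm) conn \<Rightarrow> ('a, 'm) tensor2 \<Rightarrow>
     ('a \<Rightarrow> real ^ 'm) \<Rightarrow> ('a \<Rightarrow> real ^ 'm) \<Rightarrow> ('a \<Rightarrow> real ^ 'm) \<Rightarrow> 'a \<Rightarrow> real" where
  "cov_deriv2 M nabla S X V W p =
     differential M (\<lambda>q. S q (V q) (W q)) p (X p)
     - S p (nabla V p (X p)) (W p) - S p (V p) (nabla W p (X p))"

definition divergence ::
    "('a, 'm::finite) mfd \<Rightarrow> ('a, 'm) tensor2 \<Rightarrow> ('a, 'm, 'm) conn \<Rightarrow> ('a, 'm) tensor2 \<Rightarrow>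
     ('a \<Rightarrow> real ^ 'm) \<Rightarrow> 'a \<Rightarrow> real" where
  "divergence M g nabla S Y p =
     (let e = frame_at M g p in \<Sum>i\<in>UNIV. cov_deriv2 M nabla S (e i) (e i) Y p)"


section \<open>Tension fields and stress-energy tensor of a map\<close>

definition hs_norm ::
    "('a, 'm::finite) mfd \<Rightarrow> ('a, 'm) tensor2 \<Rightarrow> ('b, 'n::finite) mfd \<Rightarrow> ('b, 'n) tensor2 \<Rightarrow>
     ('a \<Rightarrow> 'b) \<Rightarrow> 'a \<Rightarrow> real" where
  "hs_norm M g N h \<psi> p =
     (let e = frame_at M g p in
      sqrt (\<Sum>i\<in>UNIV. h (\<psi> p) (tangent_map M N \<psi> p (e i p)) (tangent_map M N \<psi> p (e i p))))"

text \<open>\<open>(\<nabla>\<^sub>Xd\<psi>)(Y)\<close>\<close>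

definition cov_deriv_tangent_map ::
    "('a, 'm::finite) mfd \<Rightarrow> ('b, 'n::finite) mfd \<Rightarrow> ('a, 'm, 'm) conn \<Rightarrow> ('a, 'm, 'n) conn \<Rightarrow>
     ('a \<Rightarrow> 'b) \<Rightarrow> ('a \<Rightarrow> real ^ 'm) \<Rightarrow> ('a \<Rightarrow> real ^ 'm) \<Rightarrow> 'a \<Rightarrow> real ^ 'n" where
  "cov_deriv_tangent_map M N nabla D \<psi> X Y p =
     D (\<lambda>q. tangent_map M N \<psi> q (Y q)) p (X p) - tangent_map M N \<psi> p (nabla Y p (X p))"

definition tension ::
    "('a, 'm::finite) mfd \<Rightarrow> ('a, 'm) tensor2 \<Rightarrow> ('b, 'n::finite) mfd \<Rightarrow>
     ('a, 'm, 'm) conn \<Rightarrow> ('a, 'm, 'n) conn \<Rightarrow> ('a \<Rightarrow> 'b) \<Rightarrow> 'a \<Rightarrow> real ^ 'n" where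
  "tension M g N nabla D \<psi> p =
     (let e = frame_at M g p in
      \<Sum>i\<in>UNIV. cov_deriv_tangent_map M N nabla D \<psi> (e i) (e i) p)"

definition alpha_tension ::
    "real \<Rightarrow> ('a, 'm::finite) mfd \<Rightarrow> ('a, 'm) tensor2 \<Rightarrow> ('b, 'n::finite) mfd \<Rightarrow> ('b, 'n) tensor2 \<Rightarrow>
     ('a, 'm, 'm) conn \<Rightarrow> ('a, 'm, 'n) conn \<Rightarrow> ('a \<Rightarrow> 'b) \<Rightarrow> 'a \<Rightarrow> real ^ 'n" where
  "alpha_tension \<alpha> M g N h nabla D \<psi> p =
     (let w = (\<lambda>q. 2 * \<alpha> * (1 + (hs_norm M g N h \<psi> q)\<^sup>2) powr (\<alpha> - 1)) in
      w p *\<^sub>R tension M g N nabla D \<psi> p + tangent_map M N \<psi> p (gradient M g w p))"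

definition alpha_stress_energy ::
    "real \<Rightarrow> ('a, 'm::finite) mfd \<Rightarrow> ('a, 'm) tensor2 \<Rightarrow> ('b, 'n::finite) mfd \<Rightarrow> ('b, 'n) tensor2 \<Rightarrow>
     ('a \<Rightarrow> 'b) \<Rightarrow> ('a, 'm) tensor2" where
  "alpha_stress_energy \<alpha> M g N h \<psi> p u v =
     (1 + (hs_norm M g N h \<psi> p)\<^sup>2) powr \<alpha> * g p u v
     - 2 * \<alpha> * (1 + (hs_norm M g N h \<psi> p)\<^sup>2) powr (\<alpha> - 1)
       * h (\<psi> p) (tangent_map M N \<psi> p u) (tangent_map M N \<psi> p v)"

end

theory Submission
  imports Defs
begin

text \<open>
  In a local orthonormal frame \<open>e\<^sub>i\<close>, write \<open>F = |d\<psi>|\<^sup>2 = \<Sum>\<^sub>i h(d\<psi> e\<^sub>i, d\<psi> e\<^sub>i)\<close>,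
  \<open>f = (1 + F)\<^sup>\<alpha>\<close> and \<open>w = 2 \<alpha> (1 + F)\<^bsup>\<alpha> - 1\<^esup>\<close>, so that \<open>df = (w / 2) dF\<close>. The Leibniz rule gives
  \<open>div S(Y) = df(Y) - h(d\<psi>(grad w), d\<psi> Y) - w h(\<tau>(\<psi>), d\<psi> Y)
    - w \<Sum>\<^sub>i h(d\<psi> e\<^sub>i, (\<nabla>d\<psi>)(e\<^sub>i, Y))\<close>.
  Metric compatibility along \<open>\<psi>\<close> gives \<open>df(Y) = w \<Sum>\<^sub>i h(d\<psi> e\<^sub>i, (\<nabla>d\<psi>)(Y, e\<^sub>i))\<close>, where the terms
  with \<open>\<nabla>\<^sub>Y e\<^sub>i\<close> cancel by antisymmetry. The second fundamental form \<open>\<nabla>d\<psi>\<close> is symmetric because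
  both Levi-Civita connections are torsion free, so the first and the last term cancel. The two
  facts about the induced connection are obtained by expanding sections of \<open>\<psi>\<^sup>-\<^sup>1TN\<close> in
  coordinate fields of \<open>N\<close>; smooth orthonormal frames come from Gram-Schmidt.\<close>


section \<open>Calculus of smooth maps\<close>

text \<open>The encoding of tangent vectors shapes the proof. \<open>W q\<close> holds components in
  the chart selected at \<open>q\<close>, which may jump as \<open>q\<close> moves, so no section
  can be differentiated as a plain function. Smoothness and derivatives are therefore read in one
  fixed chart \<open>d\<close>, through \<open>differential N (snd d) (\<psi> q) (W q)\<close>, and
  \<open>coord_field\<close> turns components in \<open>d\<close> back into tangent vectors. A
  second obstacle is the choice of frames: divergence and tension at \<open>p\<close> use one frame
  field around \<open>p\<close>, whereas \<open>hs_norm\<close> selects a new frame at every nearby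
  point. Independence of the trace from the frame is what makes \<open>F\<close> differentiable at
  \<open>p\<close> with a usable formula. The frame is not assumed to be parallel at
  \<open>p\<close>. Its derivatives are carried along: those in direction \<open>e i\<close> are
  absorbed by the tension field, and those in direction \<open>Y\<close> only disappear after
  summation.\<close>

lemma frechet_derivative_cong_open:
  assumes "open S" "x \<in> S" "\<And>y. y \<in> S \<Longrightarrow> f y = g y"
  shows "frechet_derivative f (at x) = frechet_derivative g (at x)"
proof -
  \<comment> \<open>\<open>frechet_derivative\<close> is a choice among all such \<open>L\<close>,
    so equal sets of candidates give equal values even where no derivative exists.\<close>
  have "(f has_derivative L) (at x) \<longleftrightarrow> (g has_derivative L) (at x)" for L
    using assms has_derivative_transform_within_open[of f L x UNIV S g]
      has_derivative_transform_within_open[of g L x UNIV S f] by auto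
  then show ?thesis by (simp add: frechet_derivative_def)
qed

lemma differentiable_cong_open:
  assumes "open S" "x \<in> S" "\<And>y. y \<in> S \<Longrightarrow> f y = g y" "f differentiable (at x)"
  shows "g differentiable (at x)"
  using assms has_derivative_transform_within_open[of f _ x UNIV S g]
  unfolding differentiable_def by blast

lemma Ck_on_subset: "Ck_on k S f \<Longrightarrow> T \<subseteq> S \<Longrightarrow> Ck_on k T f"
  by (induction k arbitrary: f) (auto intro: continuous_on_subset)

lemma Ck_on_Suc_D: "Ck_on (Suc k) S f \<Longrightarrow> Ck_on k S f"
proof (induction k arbitrary: f)
  case 0
  then show ?case
    by (auto intro!: continuous_at_imp_continuous_on differentiable_imp_continuous_within)
qed auto

lemma Ck_on_cong:
  assumes "open S" "\<And>y. y \<in> S \<Longrightarrow> f y = g y" "Ck_on k S f"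
  shows "Ck_on k S g"
  using assms(2,3)
proof (induction k arbitrary: f g)
  case 0
  then show ?case using continuous_on_cong[of S S f g] by auto
next
  case (Suc k)
  have "Ck_on k S (\<lambda>x. frechet_derivative g (at x) v)" for v
  proof (rule Suc.IH)
    show "Ck_on k S (\<lambda>x. frechet_derivative f (at x) v)" using Suc.prems by auto
    show "frechet_derivative f (at y) v = frechet_derivative g (at y) v" if "y \<in> S" for y
      using frechet_derivative_cong_open[OF assms(1) that, of f g] Suc.prems(1) by simp
  qed
  moreover have "g differentiable (at x)" if "x \<in> S" for x
    using differentiable_cong_open[OF assms(1) that, of f g] Suc.prems that by auto
  ultimately show ?case by auto
qed

text \<open>Needed where the chart of the target has to change with the point, so that no single
  composition formula covers all of \<open>S\<close>.\<close>

lemma Ck_on_local: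
  assumes "\<And>x. x \<in> S \<Longrightarrow> \<exists>T. open T \<and> x \<in> T \<and> Ck_on k T f"
  shows "Ck_on k S f"
  using assms
proof (induction k arbitrary: f)
  case 0
  show ?case
  proof (simp, rule continuous_at_imp_continuous_on, rule ballI)
    fix x assume "x \<in> S"
    with 0 obtain T where "open T" "x \<in> T" "continuous_on T f" by auto
    then show "isCont f x" by (simp add: continuous_on_eq_continuous_at)
  qed
next
  case (Suc k)
  have "f differentiable (at x)" if "x \<in> S" for x using Suc.prems[OF that] by auto
  moreover have "Ck_on k S (\<lambda>x. frechet_derivative f (at x) v)" for v
    by (rule Suc.IH) (metis Suc.prems Ck_on.simps(2))
  ultimately show ?case by auto
qed

lemma Ck_on_const: "Ck_on k S (\<lambda>x. c)"
  by (induction k arbitrary: c) (auto)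

lemma Ck_on_bounded_linear:
  assumes "bounded_linear L"
  shows "Ck_on k S L"
proof (cases k)
  case 0
  then show ?thesis by (simp add: assms linear_continuous_on)
next
  case (Suc k)
  have "frechet_derivative L (at x) = L" for x
    using bounded_linear_imp_has_derivative[OF assms] frechet_derivative_at by metis
  then show ?thesis using Suc assms
    by (auto intro: Ck_on_const bounded_linear_imp_differentiable)
qed

lemma Ck_on_add:
  assumes "open S" "Ck_on k S f" "Ck_on k S g"
  shows "Ck_on k S (\<lambda>x. f x + g x)"
  using assms(2,3)
proof (induction k arbitrary: f g)
  case 0
  then show ?case by (auto intro: continuous_intros)
next
  case (Suc k)
  have "Ck_on k S (\<lambda>x. frechet_derivative (\<lambda>x. f x + g x) (at x) v)" for v
  proof (rule Ck_on_cong[OF assms(1)])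
    show "Ck_on k S (\<lambda>x. frechet_derivative f (at x) v + frechet_derivative g (at x) v)"
      using Suc by auto
    show "frechet_derivative f (at y) v + frechet_derivative g (at y) v
        = frechet_derivative (\<lambda>x. f x + g x) (at y) v" if "y \<in> S" for y
      using fun_cong[OF frechet_derivative_at[OF has_derivative_add], of f _ y g _ v] Suc.prems that
      by (simp add: frechet_derivative_works)
  qed
  then show ?case using Suc.prems by auto
qed

lemma Ck_on_sum:
  assumes "open S" "\<And>i. i \<in> I \<Longrightarrow> Ck_on k S (f i)"
  shows "Ck_on k S (\<lambda>x. \<Sum>i\<in>I. f i x)"
  using assms(2)
  by (induction I rule: infinite_finite_induct) (auto intro: Ck_on_const Ck_on_add[OF assms(1)])

text \<open>The product rule yields two products of the same kind, each with one factor
  differentiated. The induction is general in both factors so that it applies to each of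
  them.\<close>

lemma Ck_on_bilinear:
  assumes "bounded_bilinear B" "open S" "Ck_on k S f" "Ck_on k S g"
  shows "Ck_on k S (\<lambda>x. B (f x) (g x))"
  using assms(3,4)
proof (induction k arbitrary: f g)
  case 0
  then show ?case by (auto intro: bounded_bilinear.continuous_on[OF assms(1)])
next
  case (Suc k)
  have *: "((\<lambda>x. B (f x) (g x)) has_derivative
      (\<lambda>h. B (f y) (frechet_derivative g (at y) h) + B (frechet_derivative f (at y) h) (g y))) (at y)"
    if "y \<in> S" for y
    using Suc.prems that by (auto intro: bounded_bilinear.FDERIV[OF assms(1)] simp: frechet_derivative_works)
  have "Ck_on k S (\<lambda>x. frechet_derivative (\<lambda>x. B (f x) (g x)) (at x) v)" for v
  proof (rule Ck_on_cong[OF assms(2)])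
    show "Ck_on k S (\<lambda>x. B (f x) (frechet_derivative g (at x) v)
        + B (frechet_derivative f (at x) v) (g x))"
      using Suc by (intro Ck_on_add assms Suc.IH) (auto intro: Ck_on_Suc_D)
    show "B (f y) (frechet_derivative g (at y) v) + B (frechet_derivative f (at y) v) (g y)
        = frechet_derivative (\<lambda>x. B (f x) (g x)) (at y) v" if "y \<in> S" for y
      using frechet_derivative_at[OF *[OF that]] by metis
  qed
  then show ?case using * by (auto simp: differentiable_def)
qed

lemmas Ck_on_scaleR = Ck_on_bilinear[OF bounded_bilinear_scaleR]

text \<open>The chain rule gives \<open>D(g \<circ> f)(x) v = Dg(f x)(Df(x) v)\<close>, where the direction of the outer
  derivative varies with \<open>x\<close>; expanding it in a basis reduces to derivatives in fixed directions.\<close>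

lemma frechet_derivative_Basis_expansion:
  fixes g :: "'a::euclidean_space \<Rightarrow> 'b::real_normed_vector"
  assumes "g differentiable (at y)"
  shows "frechet_derivative g (at y) w
    = (\<Sum>b\<in>Basis. (w \<bullet> b) *\<^sub>R frechet_derivative g (at y) b)"
proof -
  have l: "linear (frechet_derivative g (at y))"
    using assms by (rule linear_frechet_derivative)
  have "frechet_derivative g (at y) w
      = frechet_derivative g (at y) (\<Sum>b\<in>Basis. (w \<bullet> b) *\<^sub>R b)"
    by (simp add: euclidean_representation)
  then show ?thesis by (simp add: linear_sum[OF l] linear_scale[OF l])
qed

lemma Ck_on_compose:
  fixes g :: "'b::euclidean_space \<Rightarrow> 'c::real_normed_vector"
    and f :: "'a::real_normed_vector \<Rightarrow> 'b"
  assumes "open S" "f ` S \<subseteq> T" "Ck_on k S f" "Ck_on k T g"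
  shows "Ck_on k S (g \<circ> f)"
  using assms(3,4)
proof (induction k arbitrary: g)
  case 0
  then show ?case using assms(2) by (auto intro!: continuous_on_compose intro: continuous_on_subset simp del: comp_apply)
next
  case (Suc k)
  have *: "((g \<circ> f) has_derivative
      frechet_derivative g (at (f y)) \<circ> frechet_derivative f (at y)) (at y)" if "y \<in> S" for y
    using Suc.prems that assms(2)
    by (auto intro!: diff_chain_at simp flip: frechet_derivative_works)
  have "Ck_on k S (\<lambda>x. frechet_derivative (g \<circ> f) (at x) v)" for v
  proof (rule Ck_on_cong[OF assms(1)])
    \<comment> \<open>Only \<open>g\<close> varies in the induction: each directional derivative of
      \<open>g\<close> is again composed with the same \<open>f\<close>, which merely drops one
      degree.\<close>
    show "Ck_on k S (\<lambda>x. \<Sum>b\<in>Basis. (frechet_derivative f (at x) v \<bullet> b) *\<^sub>R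
        ((\<lambda>z. frechet_derivative g (at z) b) \<circ> f) x)"
    proof (intro Ck_on_sum Ck_on_scaleR assms(1) Suc.IH)
      fix b :: 'b
      show "Ck_on k S (\<lambda>x. frechet_derivative f (at x) v \<bullet> b)"
        by (rule Ck_on_bilinear[OF bounded_bilinear_inner assms(1)])
          (use Suc.prems in \<open>auto intro: Ck_on_const\<close>)
    qed (use Suc.prems Ck_on_Suc_D in auto)
    show "(\<Sum>b\<in>Basis. (frechet_derivative f (at y) v \<bullet> b) *\<^sub>R
        ((\<lambda>z. frechet_derivative g (at z) b) \<circ> f) y) = frechet_derivative (g \<circ> f) (at y) v"
      if "y \<in> S" for y
    proof -
      have "g differentiable (at (f y))" using Suc.prems assms(2) that by auto
      then show ?thesis
        unfolding frechet_derivative_at[OF *[OF that], symmetric] comp_apply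
        by (rule frechet_derivative_Basis_expansion[symmetric])
    qed
  qed
  moreover have "(g \<circ> f) differentiable (at x)" if "x \<in> S" for x
    using *[OF that] by (rule differentiableI)
  ultimately show ?case unfolding Ck_on.simps(2) by (intro conjI ballI allI)
qed

lemma Ck_on_powr: "Ck_on k {0<..} (\<lambda>x::real. x powr a)"
proof (induction k arbitrary: a)
  case 0
  then show ?case by (auto intro!: continuous_intros)
next
  case (Suc k)
  have *: "((\<lambda>x. x powr a) has_derivative (\<lambda>h. (a * y powr (a - 1)) * h)) (at y)"
    if "y \<in> {0<..}" for y :: real
    using has_real_derivative_powr[of y a] that by (simp add: has_field_derivative_def)
  have "Ck_on k {0<..} (\<lambda>x. frechet_derivative (\<lambda>x::real. x powr a) (at x) v)" for v
  proof (rule Ck_on_cong)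
    show "Ck_on k {0<..} (\<lambda>x. (a * v) *\<^sub>R x powr (a - 1))"
      by (intro Ck_on_scaleR Ck_on_const Suc) auto
    show "(a * v) *\<^sub>R y powr (a - 1) = frechet_derivative (\<lambda>x::real. x powr a) (at y) v"
      if "y \<in> {0<..}" for y
      using fun_cong[OF frechet_derivative_at[OF *[OF that]], of v] by (simp add: mult_ac)
  qed auto
  then show ?case using * by (auto simp: differentiable_def)
qed

section \<open>Closure properties of smooth maps\<close>

lemma smooth_on_subset: "smooth_on S f \<Longrightarrow> T \<subseteq> S \<Longrightarrow> smooth_on T f"
  by (auto simp: smooth_on_def intro: Ck_on_subset)

lemma smooth_on_cong:
  "open S \<Longrightarrow> (\<And>y. y \<in> S \<Longrightarrow> f y = g y) \<Longrightarrow> smooth_on S f \<Longrightarrow> smooth_on S g"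
  unfolding smooth_on_def using Ck_on_cong by blast

lemma smooth_on_local:
  "(\<And>x. x \<in> S \<Longrightarrow> \<exists>T. open T \<and> x \<in> T \<and> smooth_on T f) \<Longrightarrow> smooth_on S f"
  unfolding smooth_on_def using Ck_on_local[of S _ f] by meson

lemma smooth_on_const: "smooth_on S (\<lambda>x. c)"
  by (simp add: smooth_on_def Ck_on_const)

lemma smooth_on_bounded_linear: "bounded_linear L \<Longrightarrow> smooth_on S L"
  by (simp add: smooth_on_def Ck_on_bounded_linear)

lemma smooth_on_add:
  "open S \<Longrightarrow> smooth_on S f \<Longrightarrow> smooth_on S g \<Longrightarrow> smooth_on S (\<lambda>x. f x + g x)"
  by (simp add: smooth_on_def Ck_on_add)

lemma smooth_on_sum:
  "open S \<Longrightarrow> (\<And>i. i \<in> I \<Longrightarrow> smooth_on S (f i)) \<Longrightarrow> smooth_on S (\<lambda>x. \<Sum>i\<in>I. f i x)"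
  by (simp add: smooth_on_def Ck_on_sum)

lemma smooth_on_scaleR:
  "open S \<Longrightarrow> smooth_on S f \<Longrightarrow> smooth_on S g \<Longrightarrow> smooth_on S (\<lambda>x. f x *\<^sub>R g x)"
  by (simp add: smooth_on_def Ck_on_scaleR)

lemma smooth_on_inner:
  "open S \<Longrightarrow> smooth_on S f \<Longrightarrow> smooth_on S g \<Longrightarrow> smooth_on S (\<lambda>x. f x \<bullet> g x)"
  by (simp add: smooth_on_def Ck_on_bilinear[OF bounded_bilinear_inner])

lemma smooth_on_compose:
  fixes g :: "'b::euclidean_space \<Rightarrow> 'c::real_normed_vector"
  shows "open S \<Longrightarrow> f ` S \<subseteq> T \<Longrightarrow> smooth_on S f \<Longrightarrow> smooth_on T g \<Longrightarrow> smooth_on S (g \<circ> f)"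
  unfolding smooth_on_def using Ck_on_compose by blast

lemma smooth_on_powr: "smooth_on {0<..} (\<lambda>x::real. x powr a)"
  by (simp add: smooth_on_def Ck_on_powr)

lemma smooth_on_imp_differentiable: "smooth_on S f \<Longrightarrow> x \<in> S \<Longrightarrow> f differentiable (at x)"
  unfolding smooth_on_def using Ck_on.simps(2) by metis

lemma smooth_on_imp_continuous_on: "smooth_on S f \<Longrightarrow> continuous_on S f"
  unfolding smooth_on_def using Ck_on.simps(1) by metis

text \<open>Smoothness by definition concerns fixed directions; this version lets the direction move
  with the point, as for a vector field acting on a function.\<close>

lemma smooth_on_frechet_derivative:
  fixes f :: "'a::euclidean_space \<Rightarrow> 'b::real_normed_vector"
  assumes "open S" "smooth_on S f" "smooth_on S w"
  shows "smooth_on S (\<lambda>x. frechet_derivative f (at x) (w x))"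
proof (rule smooth_on_cong[OF assms(1)])
  show "smooth_on S (\<lambda>x. \<Sum>b\<in>Basis. (w x \<bullet> b) *\<^sub>R frechet_derivative f (at x) b)"
  proof (intro smooth_on_sum smooth_on_scaleR smooth_on_inner smooth_on_const assms)
    show "smooth_on S (\<lambda>x. frechet_derivative f (at x) b)" for b
      using assms(2) unfolding smooth_on_def using Ck_on.simps(2) by blast
  qed
qed (use assms frechet_derivative_Basis_expansion smooth_on_imp_differentiable in metis)


section \<open>Smooth functions on manifolds\<close>

text \<open>Extends \<open>smooth_fun\<close> to vector values, so that coordinate maps and
  component vectors of sections share one set of closure rules with scalar functions.\<close>

definition smooth_vfun ::
    "('a, 'm::finite) mfd \<Rightarrow> 'a set \<Rightarrow> ('a \<Rightarrow> 'v::real_normed_vector) \<Rightarrow> bool" where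
  "smooth_vfun M U f \<longleftrightarrow> (\<forall>c\<in>atlas M. smooth_on (snd c ` (fst c \<inter> U)) (f \<circ> cinv c))"

lemma smooth_fun_iff: "smooth_fun M U f \<longleftrightarrow> smooth_vfun M U f"
  by (simp add: smooth_fun_def smooth_vfun_def)

lemma smooth_section_iff:
  "smooth_section M N \<psi> U W \<longleftrightarrow>
    (\<forall>d\<in>atlas N. smooth_vfun M (U \<inter> \<psi> -` fst d) (\<lambda>q. differential N (snd d) (\<psi> q) (W q)))"
  by (auto simp: smooth_section_def smooth_vfun_def Int_assoc)

lemma smooth_map_iff:
  "smooth_map M N \<psi> \<longleftrightarrow> continuous_map (mtop M) (mtop N) \<psi> \<and>
    (\<forall>d\<in>atlas N. smooth_vfun M (\<psi> -` fst d) (snd d \<circ> \<psi>))"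
  by (auto simp: smooth_map_def smooth_vfun_def)

lemma smooth_manifold_chartD:
  assumes "smooth_manifold M" "c \<in> atlas M"
  shows "openin (mtop M) (fst c)" "open (snd c ` fst c)"
    "homeomorphic_map (subtopology (mtop M) (fst c)) (top_of_set (snd c ` fst c)) (snd c)"
  using assms unfolding smooth_manifold_def by blast+

lemma chart_subset_points: "smooth_manifold M \<Longrightarrow> c \<in> atlas M \<Longrightarrow> fst c \<subseteq> points M"
  by (simp add: openin_subset smooth_manifold_chartD)

lemma cinv_chart:
  assumes "smooth_manifold M" "c \<in> atlas M" "p \<in> fst c"
  shows "cinv c (snd c p) = p"
proof -
  have "inj_on (snd c) (topspace (subtopology (mtop M) (fst c)))"
    using homeomorphic_imp_injective_map[OF smooth_manifold_chartD(3)[OF assms(1,2)]] .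
  then have "inj_on (snd c) (fst c)"
    using chart_subset_points[OF assms(1,2)] by (simp add: Int_absorb1)
  then show ?thesis unfolding cinv_def using assms(3) by simp
qed

lemma chart_at_in:
  assumes "smooth_manifold M" "p \<in> points M"
  shows "chart_at M p \<in> atlas M" "p \<in> fst (chart_at M p)"
proof -
  have "\<exists>c. c \<in> atlas M \<and> p \<in> fst c" using assms unfolding smooth_manifold_def by blast
  then have "chart_at M p \<in> atlas M \<and> p \<in> fst (chart_at M p)"
    unfolding chart_at_def by (rule someI_ex)
  then show "chart_at M p \<in> atlas M" "p \<in> fst (chart_at M p)" by auto
qed

lemma open_chart_image:
  assumes "smooth_manifold M" "c \<in> atlas M" "openin (mtop M) U"
  shows "open (snd c ` (fst c \<inter> U))"
proof -
  have "openin (subtopology (mtop M) (fst c)) (fst c \<inter> U)"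
    using assms(3) by (metis Int_commute openin_subtopology_Int)
  then have "openin (top_of_set (snd c ` fst c)) (snd c ` (fst c \<inter> U))"
    using homeomorphic_imp_open_map[OF smooth_manifold_chartD(3)[OF assms(1,2)]]
    by (simp add: open_map_def)
  then show ?thesis using smooth_manifold_chartD(2)[OF assms(1,2)] openin_open_trans by blast
qed

lemma openin_chart_vimage:
  assumes "smooth_manifold M" "c \<in> atlas M" "open T"
  shows "openin (mtop M) (fst c \<inter> snd c -` T)"
proof -
  have "continuous_map (subtopology (mtop M) (fst c)) (top_of_set (snd c ` fst c)) (snd c)"
    using homeomorphic_imp_continuous_map[OF smooth_manifold_chartD(3)[OF assms(1,2)]] .
  then have "openin (subtopology (mtop M) (fst c))
      {q \<in> topspace (subtopology (mtop M) (fst c)). snd c q \<in> snd c ` fst c \<inter> T}"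
    using assms(3) openin_open_Int openin_continuous_map_preimage by blast
  moreover have "{q \<in> topspace (subtopology (mtop M) (fst c)). snd c q \<in> snd c ` fst c \<inter> T}
      = fst c \<inter> snd c -` T"
    using chart_subset_points[OF assms(1,2)] by auto
  ultimately show ?thesis
    using smooth_manifold_chartD(1)[OF assms(1,2)] openin_trans_full by metis
qed

text \<open>Outside \<open>points M\<close> the map is arbitrary, so a preimage is known to be open
  only after intersection with an open part of the manifold.\<close>

lemma openin_Int_vimage:
  fixes M :: "('a, 'm) mfd" and N :: "('b, 'n) mfd"
  assumes "continuous_map (mtop M) (mtop N) \<psi>" "openin (mtop M) U" "openin (mtop N) V"
  shows "openin (mtop M) (U \<inter> \<psi> -` V)"
proof -
  have "U \<inter> \<psi> -` V = U \<inter> {q \<in> points M. \<psi> q \<in> V}"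
    using openin_subset[OF assms(2)] by auto
  then show ?thesis
    using openin_Int[OF assms(2) openin_continuous_map_preimage[OF assms(1,3)]] by simp
qed

lemma smooth_vfun_subset: "smooth_vfun M U f \<Longrightarrow> U' \<subseteq> U \<Longrightarrow> smooth_vfun M U' f"
  unfolding smooth_vfun_def by (meson Int_mono image_mono order_refl smooth_on_subset)

lemma smooth_vfun_cong:
  assumes "smooth_manifold M" "openin (mtop M) U" "\<And>q. q \<in> U \<Longrightarrow> f q = f' q" "smooth_vfun M U f"
  shows "smooth_vfun M U f'"
  unfolding smooth_vfun_def
proof
  fix c assume c: "c \<in> atlas M"
  show "smooth_on (snd c ` (fst c \<inter> U)) (f' \<circ> cinv c)"
    by (rule smooth_on_cong[OF open_chart_image[OF assms(1) c assms(2)], of "f \<circ> cinv c"])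
      (use assms c cinv_chart[OF assms(1) c] in \<open>auto simp: smooth_vfun_def\<close>)
qed

lemma smooth_vfun_chartD:
  assumes "smooth_vfun M U f" "c \<in> atlas M" "q \<in> fst c" "q \<in> U"
  shows "(f \<circ> cinv c) differentiable (at (snd c q))"
  using assms smooth_on_imp_differentiable unfolding smooth_vfun_def by (metis IntI imageI)

lemma smooth_vfun_const: "smooth_vfun M U (\<lambda>q. a)"
  by (simp add: smooth_vfun_def o_def smooth_on_const)

lemma smooth_vfun_add:
  assumes "smooth_manifold M" "openin (mtop M) U" "smooth_vfun M U f" "smooth_vfun M U f'"
  shows "smooth_vfun M U (\<lambda>q. f q + f' q)"
  using assms open_chart_image[OF assms(1) _ assms(2)]
  by (auto simp: smooth_vfun_def o_def intro!: smooth_on_add)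

lemma smooth_vfun_sum:
  assumes "smooth_manifold M" "openin (mtop M) U" "\<And>i. i \<in> I \<Longrightarrow> smooth_vfun M U (f i)"
  shows "smooth_vfun M U (\<lambda>q. \<Sum>i\<in>I. f i q)"
  using assms open_chart_image[OF assms(1) _ assms(2)]
  by (auto simp: smooth_vfun_def o_def intro!: smooth_on_sum)

lemma smooth_vfun_scaleR:
  assumes "smooth_manifold M" "openin (mtop M) U" "smooth_vfun M U f" "smooth_vfun M U f'"
  shows "smooth_vfun M U (\<lambda>q. f q *\<^sub>R f' q)"
  using assms open_chart_image[OF assms(1) _ assms(2)]
  by (auto simp: smooth_vfun_def o_def intro!: smooth_on_scaleR)

lemma smooth_vfun_mult:
  fixes f f' :: "'a \<Rightarrow> real"
  assumes "smooth_manifold M" "openin (mtop M) U" "smooth_vfun M U f" "smooth_vfun M U f'"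
  shows "smooth_vfun M U (\<lambda>q. f q * f' q)"
  using smooth_vfun_scaleR[OF assms] by simp

lemma smooth_vfun_compose:
  fixes f :: "'a \<Rightarrow> 'v::euclidean_space" and F :: "'v \<Rightarrow> 'w::real_normed_vector"
  assumes "smooth_manifold M" "openin (mtop M) U" "smooth_vfun M U f" "smooth_on T F" "f ` U \<subseteq> T"
  shows "smooth_vfun M U (\<lambda>q. F (f q))"
  unfolding smooth_vfun_def
proof
  fix c assume c: "c \<in> atlas M"
  have "smooth_on (snd c ` (fst c \<inter> U)) (F \<circ> (f \<circ> cinv c))"
    by (rule smooth_on_compose[OF open_chart_image[OF assms(1) c assms(2)] _ _ assms(4)])
      (use assms c cinv_chart[OF assms(1) c] in \<open>auto simp: smooth_vfun_def\<close>)
  then show "smooth_on (snd c ` (fst c \<inter> U)) ((\<lambda>q. F (f q)) \<circ> cinv c)" by (simp add: o_def)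
qed

lemma smooth_vfun_chart: "smooth_manifold M \<Longrightarrow> d \<in> atlas M \<Longrightarrow> smooth_vfun M (fst d) (snd d)"
  by (auto simp: smooth_vfun_def smooth_manifold_def)

lemma smooth_map_id: "smooth_manifold M \<Longrightarrow> smooth_map M M (\<lambda>q. q)"
  using smooth_vfun_chart[of M] by (simp add: smooth_map_iff o_def vimage_def)

lemma smooth_map_smooth_vfun:
  "smooth_map M N \<psi> \<Longrightarrow> d \<in> atlas N \<Longrightarrow> smooth_vfun M (\<psi> -` fst d) (snd d \<circ> \<psi>)"
  by (simp add: smooth_map_iff)

text \<open>Serves Gram-Schmidt, where the neighbourhood shrinks to the points at which the next
  vector has positive length. Continuity is available only in coordinates, hence the detour through
  a chart.\<close>

lemma openin_pos_smooth_vfun: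
  fixes f :: "'a \<Rightarrow> real"
  assumes M: "smooth_manifold M" and U: "openin (mtop M) U" and f: "smooth_vfun M U f"
  shows "openin (mtop M) {q \<in> U. 0 < f q}"
proof (subst openin_subopen, rule ballI)
  fix q assume q: "q \<in> {q \<in> U. 0 < f q}"
  then have qM: "q \<in> points M" using openin_subset[OF U] by auto
  let ?c = "chart_at M q"
  note c = chart_at_in[OF M qM]
  let ?S = "snd ?c ` (fst ?c \<inter> U)"
  have "continuous_on ?S (f \<circ> cinv ?c)"
    using f c(1) unfolding smooth_vfun_def by (blast intro: smooth_on_imp_continuous_on)
  then have o: "open (?S \<inter> (f \<circ> cinv ?c) -` {0<..})"
    using open_chart_image[OF M c(1) U] by (simp add: continuous_open_preimage)
  let ?T = "U \<inter> (fst ?c \<inter> snd ?c -` (?S \<inter> (f \<circ> cinv ?c) -` {0<..}))"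
  have "openin (mtop M) ?T" using openin_chart_vimage[OF M c(1) o] U by blast
  moreover have "q \<in> ?T" using q c cinv_chart[OF M c] by auto
  moreover have "0 < f r" if "r \<in> ?T" for r
    using that cinv_chart[OF M c(1), of r] by simp
  then have "?T \<subseteq> {q \<in> U. 0 < f q}" by blast
  ultimately show "\<exists>T. openin (mtop M) T \<and> q \<in> T \<and> T \<subseteq> {q \<in> U. 0 < f q}" by blast
qed


section \<open>The chain rule in charts\<close>

lemma open_chart_vimage:
  assumes "smooth_manifold M" "smooth_map M N \<psi>" "c \<in> atlas M" "openin (mtop N) V"
  shows "open (snd c ` (fst c \<inter> \<psi> -` V))"
proof -
  have "openin (mtop M) (fst c \<inter> \<psi> -` V)"
    using assms openin_Int_vimage smooth_manifold_chartD(1) by (metis smooth_map_def)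
  from open_chart_image[OF assms(1,3) this] show ?thesis by (simp add: Int_absorb1)
qed

text \<open>Inserting \<open>cinv d\<close> after \<open>snd d\<close> factors the map into two
  Euclidean ones. The factorisation is valid on the part of \<open>c\<close> that
  \<open>\<psi>\<close> sends into \<open>d\<close>, which is open around the point.\<close>

lemma has_derivative_charts:
  assumes M: "smooth_manifold M" and N: "smooth_manifold N" and \<psi>: "smooth_map M N \<psi>"
    and c: "c \<in> atlas M" "p \<in> fst c" and d: "d \<in> atlas N" "\<psi> p \<in> fst d"
    and L: "(\<phi> \<circ> cinv d has_derivative L) (at (snd d (\<psi> p)))"
  shows "((\<phi> \<circ> \<psi> \<circ> cinv c) has_derivative
    (\<lambda>v. L (frechet_derivative (snd d \<circ> \<psi> \<circ> cinv c) (at (snd c p)) v))) (at (snd c p))"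
proof -
  let ?S = "snd c ` (fst c \<inter> \<psi> -` fst d)" and ?f = "snd d \<circ> \<psi> \<circ> cinv c"
  have S: "open ?S"
    using open_chart_vimage[OF M \<psi> c(1)] smooth_manifold_chartD(1)[OF N d(1)] by blast
  have x: "snd c p \<in> ?S" using c d by auto
  have "smooth_on ?S ?f" using \<psi> c d by (auto simp: smooth_map_def)
  from smooth_on_imp_differentiable[OF this x]
  have f: "(?f has_derivative frechet_derivative ?f (at (snd c p))) (at (snd c p))"
    by (simp add: frechet_derivative_works)
  have "?f (snd c p) = snd d (\<psi> p)" using cinv_chart[OF M c] by simp
  with L have "(\<phi> \<circ> cinv d has_derivative L) (at (?f (snd c p)))" by simp
  from diff_chain_at[OF f this]
  have 1: "((\<phi> \<circ> cinv d) \<circ> ?f has_derivative L \<circ> frechet_derivative ?f (at (snd c p))) (at (snd c p))" .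
  have 2: "((\<phi> \<circ> cinv d) \<circ> ?f) y = (\<phi> \<circ> \<psi> \<circ> cinv c) y" if "y \<in> ?S" for y
    using that cinv_chart[OF M c(1)] cinv_chart[OF N d(1)] by auto
  show ?thesis
    using has_derivative_transform_within_open[OF 1 S x 2] by (simp only: o_def)
qed

lemma frechet_derivative_charts:
  assumes "smooth_manifold M" "smooth_manifold N" "smooth_map M N \<psi>"
    "c \<in> atlas M" "p \<in> fst c" "d \<in> atlas N" "\<psi> p \<in> fst d"
    "(\<phi> \<circ> cinv d) differentiable (at (snd d (\<psi> p)))"
  shows "frechet_derivative (\<phi> \<circ> \<psi> \<circ> cinv c) (at (snd c p)) v =
    frechet_derivative (\<phi> \<circ> cinv d) (at (snd d (\<psi> p)))
      (frechet_derivative (snd d \<circ> \<psi> \<circ> cinv c) (at (snd c p)) v)"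
  using has_derivative_charts[OF assms(1-7) assms(8)[unfolded frechet_derivative_works]]
  by (simp flip: frechet_derivative_at)

lemma frechet_derivative_change_chart:
  assumes "smooth_manifold M" "c \<in> atlas M" "p \<in> fst c" "d \<in> atlas M" "p \<in> fst d"
    "(\<phi> \<circ> cinv d) differentiable (at (snd d p))"
  shows "frechet_derivative (\<phi> \<circ> cinv c) (at (snd c p)) v =
    frechet_derivative (\<phi> \<circ> cinv d) (at (snd d p))
      (frechet_derivative (snd d \<circ> cinv c) (at (snd c p)) v)"
  using frechet_derivative_charts[OF assms(1,1) smooth_map_id[OF assms(1)] assms(2-6), of v]
  by (simp add: o_def)

lemma frechet_derivative_chart_self:
  assumes "smooth_manifold M" "c \<in> atlas M" "p \<in> fst c"
  shows "frechet_derivative (snd c \<circ> cinv c) (at (snd c p)) v = v"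
proof -
  have "frechet_derivative (snd c \<circ> cinv c) (at (snd c p))
      = frechet_derivative (\<lambda>x. x) (at (snd c p))"
    by (rule frechet_derivative_cong_open[OF smooth_manifold_chartD(2)[OF assms(1,2)]])
      (use assms cinv_chart[OF assms(1,2)] in auto)
  then show ?thesis by (simp add: frechet_derivative_ident)
qed

text \<open>Differentiability at a single point, in the very chart that \<open>differential\<close>
  uses; the product and chain rules at \<open>p\<close> ask for no more.\<close>

definition differentiable_at_mfd ::
    "('a, 'm::finite) mfd \<Rightarrow> ('a \<Rightarrow> 'v::real_normed_vector) \<Rightarrow> 'a \<Rightarrow> bool" where
  "differentiable_at_mfd M f p \<longleftrightarrow>
    (f \<circ> cinv (chart_at M p)) differentiable (at (snd (chart_at M p) p))"

lemma smooth_vfun_differentiable: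
  assumes "smooth_manifold M" "openin (mtop M) U" "smooth_vfun M U f" "p \<in> U"
  shows "differentiable_at_mfd M f p"
proof -
  have "p \<in> points M" using openin_subset[OF assms(2)] assms(4) by auto
  from chart_at_in[OF assms(1) this] show ?thesis
    unfolding differentiable_at_mfd_def using assms smooth_vfun_chartD by metis
qed

lemma linear_differential: "differentiable_at_mfd M f p \<Longrightarrow> linear (differential M f p)"
  unfolding differentiable_at_mfd_def differential_def by (rule linear_frechet_derivative)

lemma differentiable_has_derivative:
  "differentiable_at_mfd M f p \<Longrightarrow> ((\<lambda>x. f (cinv (chart_at M p) x)) has_derivative
    differential M f p) (at (snd (chart_at M p) p))"
  unfolding differentiable_at_mfd_def differential_def frechet_derivative_works by (simp add: o_def)

lemma differentialI:
  "((\<lambda>x. f (cinv (chart_at M p) x)) has_derivative L) (at (snd (chart_at M p) p)) \<Longrightarrow>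
    differential M f p = L"
  unfolding differential_def using frechet_derivative_at[of "f \<circ> cinv (chart_at M p)" L]
  by (simp add: o_def)

lemma differential_cong:
  assumes "smooth_manifold M" "openin (mtop M) U" "p \<in> U" "\<And>q. q \<in> U \<Longrightarrow> f q = f' q"
  shows "differential M f p = differential M f' p"
    "differentiable_at_mfd M f p \<longleftrightarrow> differentiable_at_mfd M f' p"
proof -
  have "p \<in> points M" using openin_subset[OF assms(2)] assms(3) by auto
  note c = chart_at_in[OF assms(1) this]
  let ?S = "snd (chart_at M p) ` (fst (chart_at M p) \<inter> U)"
  have S: "open ?S" by (rule open_chart_image[OF assms(1) c(1) assms(2)])
  have x: "snd (chart_at M p) p \<in> ?S" using c assms(3) by auto
  have eq: "(f \<circ> cinv (chart_at M p)) y = (f' \<circ> cinv (chart_at M p)) y" if "y \<in> ?S" for y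
    using that cinv_chart[OF assms(1) c(1)] assms(4) by auto
  show "differential M f p = differential M f' p"
    unfolding differential_def by (rule frechet_derivative_cong_open[OF S x eq])
  show "differentiable_at_mfd M f p \<longleftrightarrow> differentiable_at_mfd M f' p"
    unfolding differentiable_at_mfd_def
    by (rule iffI) (erule differentiable_cong_open[OF S x, rotated], simp only: eq)+
qed

text \<open>Trades the selected chart, which may jump with \<open>q\<close>, for a fixed chart
  \<open>c\<close>; the transition map is absorbed into the components of \<open>v\<close> in
  \<open>c\<close>.\<close>

lemma differential_chart:
  assumes "smooth_manifold M" "c \<in> atlas M" "q \<in> fst c" "(f \<circ> cinv c) differentiable (at (snd c q))"
  shows "differential M f q v =
    frechet_derivative (f \<circ> cinv c) (at (snd c q)) (differential M (snd c) q v)"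
proof -
  have "q \<in> points M" using chart_subset_points assms by blast
  note k = chart_at_in[OF assms(1) this]
  show ?thesis unfolding differential_def
    by (rule frechet_derivative_change_chart[OF assms(1) k assms(2-4)])
qed

lemma differential_tangent_map:
  assumes M: "smooth_manifold M" and N: "smooth_manifold N" and \<psi>: "smooth_map M N \<psi>"
    and V: "openin (mtop N) V" "smooth_vfun N V \<phi>" and p: "p \<in> points M" "\<psi> p \<in> V"
  shows "differential M (\<lambda>q. \<phi> (\<psi> q)) p v = differential N \<phi> (\<psi> p) (tangent_map M N \<psi> p v)"
proof -
  have "\<psi> p \<in> points N" using V p openin_subset by blast
  note d = chart_at_in[OF N this]
  show ?thesis
    using frechet_derivative_charts[OF M N \<psi> chart_at_in[OF M p(1)] d
        smooth_vfun_chartD[OF V(2) d p(2)], of v]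
    by (simp add: differential_def tangent_map_def o_def)
qed

lemma linear_tangent_map:
  assumes M: "smooth_manifold M" and N: "smooth_manifold N" and \<psi>: "smooth_map M N \<psi>"
    and p: "p \<in> points M"
  shows "linear (tangent_map M N \<psi> p)"
proof -
  have "\<psi> p \<in> points N" using \<psi> p by (auto simp: smooth_map_def continuous_map_def)
  note d = chart_at_in[OF N this]
  have "openin (mtop M) (points M \<inter> \<psi> -` fst (chart_at N (\<psi> p)))"
    using \<psi> smooth_manifold_chartD(1)[OF N d(1)] by (auto simp: smooth_map_def intro: openin_Int_vimage)
  moreover have "smooth_vfun M (points M \<inter> \<psi> -` fst (chart_at N (\<psi> p))) (snd (chart_at N (\<psi> p)) \<circ> \<psi>)"
    using smooth_map_smooth_vfun[OF \<psi> d(1)] smooth_vfun_subset by blast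
  ultimately have "differentiable_at_mfd M (snd (chart_at N (\<psi> p)) \<circ> \<psi>) p"
    by (rule smooth_vfun_differentiable[OF M]) (use p d in simp)
  then show ?thesis unfolding tangent_map_def by (rule linear_differential)
qed

lemma smooth_vfun_comp_map:
  fixes \<phi> :: "'b \<Rightarrow> 'v::real_normed_vector"
  assumes M: "smooth_manifold M" and N: "smooth_manifold N" and \<psi>: "smooth_map M N \<psi>"
    and U: "openin (mtop M) U" and V: "openin (mtop N) V" "smooth_vfun N V \<phi>"
  shows "smooth_vfun M (U \<inter> \<psi> -` V) (\<lambda>q. \<phi> (\<psi> q))"
  unfolding smooth_vfun_def
proof
  fix c assume c: "c \<in> atlas M"
  show "smooth_on (snd c ` (fst c \<inter> (U \<inter> \<psi> -` V))) ((\<lambda>q. \<phi> (\<psi> q)) \<circ> cinv c)"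
  \<comment> \<open>The chart of \<open>N\<close> around the image depends on the point, so
    smoothness is checked near each point separately.\<close>
  proof (rule smooth_on_local)
    fix x assume "x \<in> snd c ` (fst c \<inter> (U \<inter> \<psi> -` V))"
    then obtain p where p: "x = snd c p" "p \<in> fst c" "p \<in> U" "\<psi> p \<in> V" by auto
    let ?d = "chart_at N (\<psi> p)"
    have "\<psi> p \<in> points N" using V p openin_subset by blast
    note d = chart_at_in[OF N this]
    let ?T = "snd c ` (fst c \<inter> \<psi> -` (fst ?d \<inter> V))"
    have T: "open ?T"
      by (rule open_chart_vimage[OF M \<psi> c]) (use V smooth_manifold_chartD(1)[OF N d(1)] in auto)
    have "smooth_on ?T ((\<phi> \<circ> cinv ?d) \<circ> (snd ?d \<circ> \<psi> \<circ> cinv c))"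
    proof (rule smooth_on_compose[OF T])
      show "(snd ?d \<circ> \<psi> \<circ> cinv c) ` ?T \<subseteq> snd ?d ` (fst ?d \<inter> V)"
        using cinv_chart[OF M c] by auto
      show "smooth_on ?T (snd ?d \<circ> \<psi> \<circ> cinv c)"
        using \<psi> c d unfolding smooth_map_def by (blast intro: smooth_on_subset)
      show "smooth_on (snd ?d ` (fst ?d \<inter> V)) (\<phi> \<circ> cinv ?d)"
        using V(2) d by (simp add: smooth_vfun_def)
    qed
    then have "smooth_on ?T ((\<lambda>q. \<phi> (\<psi> q)) \<circ> cinv c)"
      by (rule smooth_on_cong[OF T, rotated])
        (use cinv_chart[OF M c] cinv_chart[OF N d(1)] in auto)
    moreover have "x \<in> ?T" using p d by auto
    ultimately show "\<exists>T. open T \<and> x \<in> T \<and> smooth_on T ((\<lambda>q. \<phi> (\<psi> q)) \<circ> cinv c)"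
      using T by blast
  qed
qed

text \<open>In a fixed chart this is a Frechet derivative in the direction of the components of
  \<open>X\<close>, and those are smooth by the definition of a smooth field.\<close>

lemma smooth_vfun_differential:
  fixes f :: "'a \<Rightarrow> 'v::real_normed_vector"
  assumes M: "smooth_manifold M" and U: "openin (mtop M) U" and f: "smooth_vfun M U f"
    and X: "smooth_vector_field M U X"
  shows "smooth_vfun M U (\<lambda>q. differential M f q (X q))"
  unfolding smooth_vfun_def
proof
  fix c assume c: "c \<in> atlas M"
  let ?S = "snd c ` (fst c \<inter> U)"
  have S: "open ?S" by (rule open_chart_image[OF M c U])
  show "smooth_on ?S ((\<lambda>q. differential M f q (X q)) \<circ> cinv c)"
  proof (rule smooth_on_cong[OF S])
    show "smooth_on ?S (\<lambda>x. frechet_derivative (f \<circ> cinv c) (at x)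
        (((\<lambda>q. differential M (snd c) q (X q)) \<circ> cinv c) x))"
    proof (rule smooth_on_frechet_derivative[OF S])
      show "smooth_on ?S (f \<circ> cinv c)" using f c by (simp add: smooth_vfun_def)
      have "smooth_on (snd c ` (fst c \<inter> U \<inter> (\<lambda>q. q) -` fst c))
          ((\<lambda>q. differential M (snd c) q (X q)) \<circ> cinv c)"
        using X c unfolding smooth_section_def by blast
      moreover have "fst c \<inter> U \<inter> (\<lambda>q. q) -` fst c = fst c \<inter> U" by auto
      ultimately show "smooth_on ?S (\<lambda>x. ((\<lambda>q. differential M (snd c) q (X q)) \<circ> cinv c) x)"
        by (simp add: comp_def)
    qed
    fix y assume "y \<in> ?S"
    then obtain q where "y = snd c q" "q \<in> fst c" "q \<in> U" by auto
    then show "frechet_derivative (f \<circ> cinv c) (at y)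
        (((\<lambda>q. differential M (snd c) q (X q)) \<circ> cinv c) y)
        = ((\<lambda>q. differential M f q (X q)) \<circ> cinv c) y"
      using differential_chart[OF M c, of q f "X q"] smooth_vfun_chartD[OF f c, of q]
        cinv_chart[OF M c, of q] by simp
  qed
qed


section \<open>Coordinate vector fields\<close>

text \<open>The vector field with constant components \<open>a\<close> in the chart
  \<open>d\<close>, rewritten at each \<open>q\<close> in the selected chart by the derivative of
  the transition map. For \<open>a = axis i 1\<close> it is the i-th coordinate field.\<close>

definition coord_field ::
    "('a, 'm::finite) mfd \<Rightarrow> ('a, 'm) chart \<Rightarrow> real ^ 'm \<Rightarrow> 'a \<Rightarrow> real ^ 'm" where
  "coord_field M d a q = frechet_derivative (snd (chart_at M q) \<circ> cinv d) (at (snd d q)) a"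

lemma differential_coord_field:
  assumes M: "smooth_manifold M" and d: "d \<in> atlas M" "q \<in> fst d"
    and V: "openin (mtop M) V" "smooth_vfun M V f" "q \<in> V"
  shows "differential M f q (coord_field M d a q) = frechet_derivative (f \<circ> cinv d) (at (snd d q)) a"
proof -
  have "q \<in> points M" using chart_subset_points M d by blast
  note k = chart_at_in[OF M this]
  show ?thesis unfolding differential_def coord_field_def
    using frechet_derivative_change_chart[OF M d k smooth_vfun_chartD[OF V(2) k V(3)]] by simp
qed

lemma differential_chart_coord_field:
  assumes M: "smooth_manifold M" and d: "d \<in> atlas M" "q \<in> fst d"
  shows "differential M (snd d) q (coord_field M d a q) = a"
  using differential_coord_field[OF M d smooth_manifold_chartD(1)[OF M d(1)]
      smooth_vfun_chart[OF M d(1)] d(2)] frechet_derivative_chart_self[OF M d] by simp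

text \<open>The derivatives of the two transition maps between \<open>d\<close> and the selected
  chart are inverse to each other.\<close>

lemma coord_field_differential:
  assumes M: "smooth_manifold M" and d: "d \<in> atlas M" "q \<in> fst d"
  shows "coord_field M d (differential M (snd d) q v) q = v"
proof -
  have "q \<in> points M" using chart_subset_points M d by blast
  note k = chart_at_in[OF M this]
  show ?thesis unfolding differential_def coord_field_def
    using frechet_derivative_change_chart[OF M k d
        smooth_vfun_chartD[OF smooth_vfun_chart[OF M k(1)] d k(2)]]
      frechet_derivative_chart_self[OF M k] by simp
qed

lemma linear_coord_field:
  assumes M: "smooth_manifold M" and d: "d \<in> atlas M" "q \<in> fst d"
  shows "linear (\<lambda>a. coord_field M d a q)"
proof -
  have "q \<in> points M" using chart_subset_points M d by blast
  note k = chart_at_in[OF M this]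
  show ?thesis unfolding coord_field_def
    by (rule linear_frechet_derivative[OF smooth_vfun_chartD[OF smooth_vfun_chart[OF M k(1)] d k(2)]])
qed

text \<open>Seen in \<open>d'\<close>, the components are the derivative of a transition map in a
  fixed direction; the source chart \<open>c\<close> contributes one more transition map.\<close>

lemma smooth_coord_field:
  assumes M: "smooth_manifold M" and d: "d \<in> atlas M"
  shows "smooth_vector_field M (fst d) (coord_field M d a)"
  unfolding smooth_section_def
proof (intro ballI)
  fix c d' assume c: "c \<in> atlas M" and d': "d' \<in> atlas M"
  let ?S = "snd c ` (fst c \<inter> fst d \<inter> (\<lambda>q. q) -` fst d')"
  have oo: "openin (mtop M) (fst d \<inter> fst d')"
    by (intro openin_Int smooth_manifold_chartD(1)[OF M] d d')
  have S: "open ?S" using open_chart_image[OF M c oo] by (simp add: Int_assoc vimage_def)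
  have T: "open (snd d ` (fst d \<inter> fst d'))"
    using open_chart_image[OF M d] smooth_manifold_chartD(1)[OF M d'] by blast
  have "smooth_on ?S ((\<lambda>y. frechet_derivative (snd d' \<circ> cinv d) (at y) a) \<circ> (snd d \<circ> cinv c))"
  proof (rule smooth_on_compose[OF S])
    show "(snd d \<circ> cinv c) ` ?S \<subseteq> snd d ` (fst d \<inter> fst d')"
      using cinv_chart[OF M c] by auto
    show "smooth_on ?S (snd d \<circ> cinv c)"
      using M c d unfolding smooth_manifold_def by (blast intro: smooth_on_subset)
    show "smooth_on (snd d ` (fst d \<inter> fst d')) (\<lambda>y. frechet_derivative (snd d' \<circ> cinv d) (at y) a)"
      using M d d' unfolding smooth_manifold_def
      by (intro smooth_on_frechet_derivative[OF T] smooth_on_const) blast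
  qed
  then show "smooth_on ?S ((\<lambda>q. differential M (snd d') q (coord_field M d a q)) \<circ> cinv c)"
  proof (rule smooth_on_cong[OF S, rotated])
    fix y assume "y \<in> ?S"
    then obtain q where "y = snd c q" "q \<in> fst c" "q \<in> fst d" "q \<in> fst d'" by auto
    then show "((\<lambda>y. frechet_derivative (snd d' \<circ> cinv d) (at y) a) \<circ> (snd d \<circ> cinv c)) y
        = ((\<lambda>q. differential M (snd d') q (coord_field M d a q)) \<circ> cinv c) y"
      using cinv_chart[OF M c] differential_coord_field[OF M d _ smooth_manifold_chartD(1)[OF M d']
          smooth_vfun_chart[OF M d'], of q a] by simp
  qed
qed


section \<open>Sections along a map\<close>

lemma linear_differential_chart:
  assumes "smooth_manifold M" "d \<in> atlas M" "q \<in> fst d"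
  shows "linear (differential M (snd d) q)"
  using linear_differential[OF smooth_vfun_differentiable[OF assms(1)
      smooth_manifold_chartD(1)[OF assms(1,2)] smooth_vfun_chart[OF assms(1,2)] assms(3)]] .

lemma differential_const: "differential M (\<lambda>q. a) p v = 0"
  by (simp add: differential_def o_def frechet_derivative_const)

lemma differential_vec_nth:
  fixes f :: "'a \<Rightarrow> real ^ 'k::finite"
  assumes "differentiable_at_mfd M f p"
  shows "differential M (\<lambda>q. f q $ l) p v = differential M f p v $ l"
proof -
  have "differential M (\<lambda>q. f q $ l) p = (\<lambda>v. differential M f p v $ l)"
    by (rule differentialI, rule bounded_linear.has_derivative[OF bounded_linear_vec_nth])
      (rule differentiable_has_derivative[OF assms])
  then show ?thesis by simp
qed

lemma bilinear_sum_sum: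
  assumes "bilinear B"
  shows "B (\<Sum>i\<in>I. f i) (\<Sum>j\<in>J. f' j) = (\<Sum>i\<in>I. \<Sum>j\<in>J. B (f i) (f' j))"
proof -
  have l: "linear (\<lambda>x. B x y)" "linear (B x)" for x y
    using assms by (auto simp: bilinear_def)
  show ?thesis by (subst linear_sum[OF l(1)]) (simp add: linear_sum[OF l(2)])
qed

lemma openin_section_domain:
  assumes "smooth_manifold N" "smooth_map M N \<psi>" "openin (mtop M) U" "d \<in> atlas N"
  shows "openin (mtop M) (U \<inter> \<psi> -` fst d)"
  using assms smooth_manifold_chartD(1)[OF assms(1,4)] openin_Int_vimage
  unfolding smooth_map_def by blast

lemma smooth_section_subset:
  assumes "smooth_section M N \<psi> U W" "U' \<subseteq> U"
  shows "smooth_section M N \<psi> U' W"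
  unfolding smooth_section_iff
proof
  fix d assume "d \<in> atlas N"
  then have "smooth_vfun M (U \<inter> \<psi> -` fst d) (\<lambda>q. differential N (snd d) (\<psi> q) (W q))"
    using assms(1) by (simp add: smooth_section_iff)
  then show "smooth_vfun M (U' \<inter> \<psi> -` fst d) (\<lambda>q. differential N (snd d) (\<psi> q) (W q))"
    by (rule smooth_vfun_subset) (use assms(2) in auto)
qed

context
  fixes M :: "('a, 'm::finite) mfd" and N :: "('b, 'n::finite) mfd" and \<psi> :: "'a \<Rightarrow> 'b"
  assumes M: "smooth_manifold M" and N: "smooth_manifold N" and \<psi>: "smooth_map M N \<psi>"
begin

lemma smooth_section_add:
  assumes U: "openin (mtop M) U" and W: "smooth_section M N \<psi> U W" "smooth_section M N \<psi> U W'"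
  shows "smooth_section M N \<psi> U (\<lambda>q. W q + W' q)"
  unfolding smooth_section_iff
proof
  fix d assume d: "d \<in> atlas N"
  note o = openin_section_domain[OF N \<psi> U d]
  show "smooth_vfun M (U \<inter> \<psi> -` fst d) (\<lambda>q. differential N (snd d) (\<psi> q) (W q + W' q))"
    by (rule smooth_vfun_cong[OF M o _ smooth_vfun_add[OF M o]])
      (use W d in \<open>auto simp: smooth_section_iff linear_add[OF linear_differential_chart[OF N d]]\<close>)
qed

lemma smooth_section_scaleR:
  assumes U: "openin (mtop M) U" and f: "smooth_vfun M U f" and W: "smooth_section M N \<psi> U W"
  shows "smooth_section M N \<psi> U (\<lambda>q. f q *\<^sub>R W q)"
  unfolding smooth_section_iff
proof
  fix d assume d: "d \<in> atlas N"
  note o = openin_section_domain[OF N \<psi> U d]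
  show "smooth_vfun M (U \<inter> \<psi> -` fst d) (\<lambda>q. differential N (snd d) (\<psi> q) (f q *\<^sub>R W q))"
    by (rule smooth_vfun_cong[OF M o _ smooth_vfun_scaleR[OF M o smooth_vfun_subset[OF f]]])
      (use W d in \<open>auto simp: smooth_section_iff linear_scale[OF linear_differential_chart[OF N d]]\<close>)
qed

lemma smooth_section_zero: "openin (mtop M) U \<Longrightarrow> smooth_section M N \<psi> U (\<lambda>q. 0)"
  unfolding smooth_section_iff
proof
  fix d assume U: "openin (mtop M) U" and d: "d \<in> atlas N"
  show "smooth_vfun M (U \<inter> \<psi> -` fst d) (\<lambda>q. differential N (snd d) (\<psi> q) 0)"
    by (rule smooth_vfun_cong[OF M openin_section_domain[OF N \<psi> U d] _ smooth_vfun_const])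
      (use d in \<open>auto simp: linear_0[OF linear_differential_chart[OF N d]]\<close>)
qed

lemma smooth_section_sum:
  assumes "openin (mtop M) U" "\<And>i. i \<in> I \<Longrightarrow> smooth_section M N \<psi> U (W i)"
  shows "smooth_section M N \<psi> U (\<lambda>q. \<Sum>i\<in>I. W i q)"
  using assms(2)
  by (induction I rule: infinite_finite_induct)
    (auto intro: smooth_section_zero smooth_section_add assms(1))

lemma smooth_section_comp_map:
  assumes U: "openin (mtop M) U" and V: "openin (mtop N) V" and Z: "smooth_vector_field N V Z"
  shows "smooth_section M N \<psi> (U \<inter> \<psi> -` V) (\<lambda>q. Z (\<psi> q))"
  unfolding smooth_section_iff
proof
  fix d assume d: "d \<in> atlas N"
  have "openin (mtop N) (V \<inter> (\<lambda>q. q) -` fst d)"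
    using V smooth_manifold_chartD(1)[OF N d] by (simp add: vimage_def openin_Int)
  moreover have "smooth_vfun N (V \<inter> (\<lambda>q. q) -` fst d) (\<lambda>r. differential N (snd d) r (Z r))"
    using Z d by (simp add: smooth_section_iff)
  ultimately have "smooth_vfun M (U \<inter> \<psi> -` (V \<inter> (\<lambda>q. q) -` fst d))
      (\<lambda>q. differential N (snd d) (\<psi> q) (Z (\<psi> q)))"
    by (rule smooth_vfun_comp_map[OF M N \<psi> U])
  then show "smooth_vfun M (U \<inter> \<psi> -` V \<inter> \<psi> -` fst d)
      (\<lambda>q. differential N (snd d) (\<psi> q) (Z (\<psi> q)))"
    by (rule smooth_vfun_subset) auto
qed

lemma differential_chart_tangent_map:
  assumes "d \<in> atlas N" "p \<in> points M" "\<psi> p \<in> fst d"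
  shows "differential N (snd d) (\<psi> p) (tangent_map M N \<psi> p v)
    = differential M (\<lambda>q. snd d (\<psi> q)) p v"
  using differential_tangent_map[OF M N \<psi> smooth_manifold_chartD(1)[OF N assms(1)]
      smooth_vfun_chart[OF N assms(1)] assms(2,3), of v] by simp

lemma smooth_vfun_chart_map:
  "d \<in> atlas N \<Longrightarrow> smooth_vfun M (U \<inter> \<psi> -` fst d) (\<lambda>q. snd d (\<psi> q))"
  using smooth_map_smooth_vfun[OF \<psi>, of d]
  by (auto simp: o_def intro: smooth_vfun_subset)

text \<open>The components in \<open>d\<close> are the derivatives of \<open>snd d\<close> composed
  with \<open>\<psi>\<close> along \<open>X\<close>, so smoothness of differentials applies.\<close>

lemma smooth_section_tangent_map:
  assumes U: "openin (mtop M) U" and X: "smooth_vector_field M U X"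
  shows "smooth_section M N \<psi> U (\<lambda>q. tangent_map M N \<psi> q (X q))"
  unfolding smooth_section_iff
proof
  fix d assume d: "d \<in> atlas N"
  note o = openin_section_domain[OF N \<psi> U d]
  show "smooth_vfun M (U \<inter> \<psi> -` fst d)
      (\<lambda>q. differential N (snd d) (\<psi> q) (tangent_map M N \<psi> q (X q)))"
  proof (rule smooth_vfun_cong[OF M o])
    show "smooth_vfun M (U \<inter> \<psi> -` fst d) (\<lambda>q. differential M (\<lambda>q. snd d (\<psi> q)) q (X q))"
      by (rule smooth_vfun_differential[OF M o smooth_vfun_chart_map[OF d]
            smooth_section_subset[OF X]]) auto
    show "differential M (\<lambda>q. snd d (\<psi> q)) q (X q)
        = differential N (snd d) (\<psi> q) (tangent_map M N \<psi> q (X q))"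
      if "q \<in> U \<inter> \<psi> -` fst d" for q
      using differential_chart_tangent_map[OF d] that openin_subset[OF U] by auto
  qed
qed

lemma smooth_section_coeff:
  assumes U: "openin (mtop M) U" and d: "d \<in> atlas N" and W: "smooth_section M N \<psi> U W"
  shows "smooth_vfun M (U \<inter> \<psi> -` fst d) (\<lambda>q. differential N (snd d) (\<psi> q) (W q) $ i)"
  by (rule smooth_vfun_compose[OF M openin_section_domain[OF N \<psi> U d] _
        smooth_on_bounded_linear[OF bounded_linear_vec_nth, of UNIV]])
    (use W d in \<open>auto simp: smooth_section_iff\<close>)

end

text \<open>Writes a section as a combination of fields pulled back from \<open>N\<close>, the
  sections on which an induced connection is prescribed.\<close>

lemma coord_field_expansion:
  assumes N: "smooth_manifold N" and d: "d \<in> atlas N" "r \<in> fst d"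
  shows "w = (\<Sum>i\<in>UNIV. (differential N (snd d) r w $ i) *\<^sub>R coord_field N d (axis i 1) r)"
proof -
  have "w = coord_field N d (\<Sum>i\<in>UNIV. (differential N (snd d) r w $ i) *\<^sub>R axis i 1) r"
    using coord_field_differential[OF N d, of w]
      basis_expansion[of "differential N (snd d) r w"] by (simp add: scalar_mult_eq_scaleR)
  then show ?thesis
    by (simp add: linear_sum[OF linear_coord_field[OF N d]]
        linear_scale[OF linear_coord_field[OF N d]])
qed


section \<open>Connections along maps\<close>

lemma connection_alongD:
  assumes "connection_along M N \<psi> D" "openin (mtop M) U" "smooth_section M N \<psi> U W" "p \<in> U"
  shows connection_linear: "linear (D W p)"
    and connection_add: "smooth_section M N \<psi> U W' \<Longrightarrow>
      D (\<lambda>q. W q + W' q) p v = D W p v + D W' p v"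
    and connection_scaleR: "smooth_vfun M U f \<Longrightarrow>
      D (\<lambda>q. f q *\<^sub>R W q) p v = differential M f p v *\<^sub>R W p + f p *\<^sub>R D W p v"
    and connection_cong: "(\<And>q. q \<in> U \<Longrightarrow> W q = W' q) \<Longrightarrow> D W p = D W' p"
proof -
  note c = assms(1)[unfolded connection_along_def smooth_fun_iff, THEN spec, THEN spec, THEN mp,
      OF assms(2), THEN mp, OF assms(3)]
  show "linear (D W p)" using c assms(4) by simp
  show "D (\<lambda>q. W q + W' q) p v = D W p v + D W' p v" if "smooth_section M N \<psi> U W'"
    using c[THEN conjunct2, THEN conjunct1] that assms(4) by simp
  show "D (\<lambda>q. f q *\<^sub>R W q) p v = differential M f p v *\<^sub>R W p + f p *\<^sub>R D W p v"
    if "smooth_vfun M U f"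
    using c[THEN conjunct2, THEN conjunct2, THEN conjunct1] that assms(4) by simp
  show "D W p = D W' p" if "\<And>q. q \<in> U \<Longrightarrow> W q = W' q"
    using c[THEN conjunct2, THEN conjunct2, THEN conjunct2, THEN conjunct1] that assms(4) by blast
qed

lemma connection_sum:
  assumes M: "smooth_manifold M" and N: "smooth_manifold N" and \<psi>: "smooth_map M N \<psi>"
    and D: "connection_along M N \<psi> D" and U: "openin (mtop M) U" and p: "p \<in> U"
    and f: "\<And>i. i \<in> I \<Longrightarrow> smooth_vfun M U (f i)"
    and W: "\<And>i. i \<in> I \<Longrightarrow> smooth_section M N \<psi> U (W i)" and "finite I"
  shows "D (\<lambda>q. \<Sum>i\<in>I. f i q *\<^sub>R W i q) p v
    = (\<Sum>i\<in>I. differential M (f i) p v *\<^sub>R W i p + f i p *\<^sub>R D (W i) p v)"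
  using \<open>finite I\<close> f W
proof (induction I rule: finite_induct)
  case empty
  \<comment> \<open>The zero section is the constant function 0 times itself, so the Leibniz rule
    gives it derivative 0.\<close>
  show ?case
    using connection_scaleR[OF D U smooth_section_zero[OF M N \<psi> U] p smooth_vfun_const[of M U 0], of v]
    by simp
next
  case (insert i I)
  have s: "smooth_section M N \<psi> U (\<lambda>q. f j q *\<^sub>R W j q)" if "j \<in> insert i I" for j
    using that insert.prems smooth_section_scaleR[OF M N \<psi> U] by blast
  then have "smooth_section M N \<psi> U (\<lambda>q. \<Sum>i\<in>I. f i q *\<^sub>R W i q)"
    using smooth_section_sum[OF M N \<psi> U, of I "\<lambda>i q. f i q *\<^sub>R W i q"] by simp
  then have "D (\<lambda>q. f i q *\<^sub>R W i q + (\<Sum>i\<in>I. f i q *\<^sub>R W i q)) p v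
      = D (\<lambda>q. f i q *\<^sub>R W i q) p v + D (\<lambda>q. \<Sum>i\<in>I. f i q *\<^sub>R W i q) p v"
    using connection_add[OF D U s p] by blast
  moreover have "D (\<lambda>q. f i q *\<^sub>R W i q) p v
      = differential M (f i) p v *\<^sub>R W i p + f i p *\<^sub>R D (W i) p v"
    using connection_scaleR[OF D U _ p] insert.prems by blast
  moreover have "D (\<lambda>q. \<Sum>i\<in>I. f i q *\<^sub>R W i q) p v
      = (\<Sum>i\<in>I. differential M (f i) p v *\<^sub>R W i p + f i p *\<^sub>R D (W i) p v)"
    using insert.IH insert.prems by blast
  ultimately show ?case by (simp only: sum.insert[OF insert.hyps])
qed

text \<open>Symmetry of the Christoffel symbols. Torsion-freeness is tested on the coordinate
  functions of \<open>d\<close>: their derivatives along coordinate fields are constant, so all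
  components of the difference vanish.\<close>

lemma coord_field_commute:
  assumes N: "smooth_manifold N" and nabla: "torsion_free N nabla"
    and d: "d \<in> atlas N" "r \<in> fst d"
  shows "nabla (coord_field N d a) r (coord_field N d b r)
    = nabla (coord_field N d b) r (coord_field N d a r)"
proof -
  let ?u = "nabla (coord_field N d a) r (coord_field N d b r)
    - nabla (coord_field N d b) r (coord_field N d a r)"
  note V = smooth_manifold_chartD(1)[OF N d(1)]
  have 1: "differential N (\<lambda>q. snd d q $ l) q (coord_field N d a q) = a $ l"
    if "q \<in> fst d" for q a l
    using differential_vec_nth[OF smooth_vfun_differentiable[OF N V smooth_vfun_chart[OF N d(1)] that]]
      differential_chart_coord_field[OF N d(1) that] by simp
  have 2: "differential N (\<lambda>q. differential N (\<lambda>q. snd d q $ l) q (coord_field N d a q)) r v = 0"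
    for a l v
    using differential_cong(1)[OF N V d(2), of "\<lambda>q. differential N (\<lambda>q. snd d q $ l) q (coord_field N d a q)" "\<lambda>q. a $ l", OF 1] differential_const[of N "a $ l" r v]
    by simp
  have "differential N (snd d) r ?u $ l = 0" for l
  proof -
    have "smooth_fun N (fst d) (\<lambda>q. snd d q $ l)" unfolding smooth_fun_iff
      by (rule smooth_vfun_compose[OF N V smooth_vfun_chart[OF N d(1)]
            smooth_on_bounded_linear[OF bounded_linear_vec_nth, of UNIV]]) auto
    then have "differential N (\<lambda>q. snd d q $ l) r ?u
      = differential N (\<lambda>q. differential N (\<lambda>q. snd d q $ l) q (coord_field N d a q)) r
          (coord_field N d b r)
        - differential N (\<lambda>q. differential N (\<lambda>q. snd d q $ l) q (coord_field N d b q)) r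
          (coord_field N d a r)"
      using nabla V smooth_coord_field[OF N d(1)] d(2) unfolding torsion_free_def by blast
    then have "differential N (\<lambda>q. snd d q $ l) r ?u = 0" by (simp only: 2)
    then show ?thesis
      using differential_vec_nth[OF smooth_vfun_differentiable[OF N V smooth_vfun_chart[OF N d(1)] d(2)]]
      by simp
  qed
  then have "differential N (snd d) r ?u = 0" by (simp add: vec_eq_iff)
  then have "?u = coord_field N d 0 r" using coord_field_differential[OF N d, of ?u] by simp
  then show ?thesis by (simp add: linear_0[OF linear_coord_field[OF N d]])
qed

context
  fixes M :: "('a, 'm::finite) mfd" and N :: "('b, 'n::finite) mfd" and \<psi> :: "'a \<Rightarrow> 'b"
    and nabla :: "('b, 'n, 'n) conn" and D :: "('a, 'm, 'n) conn"
  assumes M: "smooth_manifold M" and N: "smooth_manifold N" and \<psi>: "smooth_map M N \<psi>"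
    and ind: "induced_connection M N \<psi> nabla D"
begin

text \<open>The Leibniz rule differentiates the coefficients, and the defining property of the
  induced connection differentiates the coordinate fields. Later proofs reach \<open>D\<close> only
  through this formula.\<close>

lemma induced_connection_coord:
  assumes U: "openin (mtop M) U" and W: "smooth_section M N \<psi> U W" and p: "p \<in> U"
    and d: "d \<in> atlas N" "\<psi> p \<in> fst d"
  shows "D W p v = (\<Sum>i\<in>UNIV.
    differential M (\<lambda>q. differential N (snd d) (\<psi> q) (W q) $ i) p v
      *\<^sub>R coord_field N d (axis i 1) (\<psi> p)
    + (differential N (snd d) (\<psi> p) (W p) $ i)
      *\<^sub>R nabla (coord_field N d (axis i 1)) (\<psi> p) (tangent_map M N \<psi> p v))"
proof -
  let ?U = "U \<inter> \<psi> -` fst d"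
  let ?f = "\<lambda>i q. differential N (snd d) (\<psi> q) (W q) $ i"
  let ?E = "\<lambda>i q. coord_field N d (axis i 1) (\<psi> q)"
  have D: "connection_along M N \<psi> D" using ind by (simp add: induced_connection_def)
  have o: "openin (mtop M) ?U" by (rule openin_section_domain[OF N \<psi> U d(1)])
  have pU: "p \<in> ?U" and pM: "p \<in> points M" using p d openin_subset[OF U] by auto
  \<comment> \<open>The expansion holds only on \<open>?U\<close>, which is enough because
    \<open>D\<close> depends on the germ at \<open>p\<close>.\<close>
  have "D W p = D (\<lambda>q. \<Sum>i\<in>UNIV. ?f i q *\<^sub>R ?E i q) p"
  proof (rule connection_cong[OF D o _ pU])
    show "smooth_section M N \<psi> ?U W" by (rule smooth_section_subset[OF W]) auto
    show "W q = (\<Sum>i\<in>UNIV. ?f i q *\<^sub>R ?E i q)" if "q \<in> ?U" for q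
      using coord_field_expansion[OF N d(1), of "\<psi> q" "W q"] that by simp
  qed
  then have "D W p v = (\<Sum>i\<in>UNIV. differential M (?f i) p v *\<^sub>R ?E i p + ?f i p *\<^sub>R D (?E i) p v)"
    using connection_sum[OF M N \<psi> D o pU, of UNIV ?f ?E v]
      smooth_section_coeff[OF M N \<psi> U d(1) W]
      smooth_section_comp_map[OF M N \<psi> U smooth_manifold_chartD(1)[OF N d(1)] smooth_coord_field[OF N d(1)]]
    by simp
  moreover have "D (?E i) p v = nabla (coord_field N d (axis i 1)) (\<psi> p) (tangent_map M N \<psi> p v)" for i
    using ind smooth_manifold_chartD(1)[OF N d(1)] smooth_coord_field[OF N d(1)] d(2) pM
    unfolding induced_connection_def by blast
  ultimately show ?thesis by simp
qed

text \<open>After expansion in coordinate fields, the ordinary product rule handles the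
  coefficients, and only the functions \<open>h (E i) (E j)\<close> need compatibility on
  \<open>N\<close>.\<close>

lemma induced_connection_metric:
  assumes h: "riemannian_metric N h" and comp: "metric_compatible N h nabla"
    and U: "openin (mtop M) U" and p: "p \<in> U"
    and W: "smooth_section M N \<psi> U W" and W': "smooth_section M N \<psi> U W'"
  shows "differentiable_at_mfd M (\<lambda>q. h (\<psi> q) (W q) (W' q)) p"
    and "differential M (\<lambda>q. h (\<psi> q) (W q) (W' q)) p v
      = h (\<psi> p) (D W p v) (W' p) + h (\<psi> p) (W p) (D W' p v)"
proof -
  have pM: "p \<in> points M" and pN: "\<psi> p \<in> points N"
    using \<psi> p openin_subset[OF U] by (auto simp: smooth_map_def continuous_map_def)
  define d where "d = chart_at N (\<psi> p)"
  have d: "d \<in> atlas N" "\<psi> p \<in> fst d" using chart_at_in[OF N pN] by (auto simp: d_def)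
  note V = smooth_manifold_chartD(1)[OF N d(1)]
  let ?U = "U \<inter> \<psi> -` fst d"
  define a where "a i q = differential N (snd d) (\<psi> q) (W q) $ i" for i q
  define b where "b i q = differential N (snd d) (\<psi> q) (W' q) $ i" for i q
  define E where "E i = coord_field N d (axis i 1)" for i
  define H where "H i j q = h (\<psi> q) (E i (\<psi> q)) (E j (\<psi> q))" for i j q
  define dv where "dv = tangent_map M N \<psi> p v"
  have bil: "bilinear (h r)" if "r \<in> points N" for r
    using h that by (simp add: riemannian_metric_def)
  have o: "openin (mtop M) ?U" by (rule openin_section_domain[OF N \<psi> U d(1)])
  have pU: "p \<in> ?U" using p d by auto
  have E: "smooth_vector_field N (fst d) (E i)" for i
    unfolding E_def by (rule smooth_coord_field[OF N d(1)])
  have hE: "smooth_vfun N (fst d) (\<lambda>r. h r (E i r) (E j r))" for i j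
    using h V E unfolding riemannian_metric_def smooth_fun_iff by blast
  have a: "smooth_vfun M ?U (a i)" and b: "smooth_vfun M ?U (b i)" and H: "smooth_vfun M ?U (H i j)" for i j
    using smooth_section_coeff[OF M N \<psi> U d(1) W] smooth_section_coeff[OF M N \<psi> U d(1) W']
      smooth_vfun_comp_map[OF M N \<psi> U V hE]
    by (simp_all add: a_def[abs_def] b_def[abs_def] H_def[abs_def])
  have eq: "h (\<psi> q) (W q) (W' q) = (\<Sum>i\<in>UNIV. \<Sum>j\<in>UNIV. (a i q * b j q) * H i j q)"
    if "q \<in> ?U" for q
  proof -
    have "\<psi> q \<in> fst d" "\<psi> q \<in> points N" using that openin_subset[OF V] by auto
    note B = bil[OF this(2)]
    have "h (\<psi> q) (W q) (W' q)
        = h (\<psi> q) (\<Sum>i\<in>UNIV. a i q *\<^sub>R E i (\<psi> q)) (\<Sum>j\<in>UNIV. b j q *\<^sub>R E j (\<psi> q))"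
      unfolding a_def b_def E_def using coord_field_expansion[OF N d(1) \<open>\<psi> q \<in> fst d\<close>] by simp
    then show ?thesis
      by (simp add: bilinear_sum_sum[OF B] bilinear_lmul[OF B] bilinear_rmul[OF B] H_def mult_ac)
  qed
  have "smooth_vfun M ?U (\<lambda>q. \<Sum>i\<in>UNIV. \<Sum>j\<in>UNIV. (a i q * b j q) * H i j q)"
    by (intro smooth_vfun_sum[OF M o] smooth_vfun_mult[OF M o] a b H)
  from smooth_vfun_differentiable[OF M o this pU]
  show "differentiable_at_mfd M (\<lambda>q. h (\<psi> q) (W q) (W' q)) p"
    using differential_cong(2)[OF M o pU eq] by simp
  note dd = differentiable_has_derivative[OF smooth_vfun_differentiable[OF M o _ pU]]
  have cp: "cinv (chart_at M p) (snd (chart_at M p) p) = p"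
    using cinv_chart[OF M chart_at_in[OF M pM]] .
  have "differential M (\<lambda>q. h (\<psi> q) (W q) (W' q)) p
      = differential M (\<lambda>q. \<Sum>i\<in>UNIV. \<Sum>j\<in>UNIV. (a i q * b j q) * H i j q) p"
    by (rule differential_cong(1)[OF M o pU eq])
  also have "\<dots> = (\<lambda>v. \<Sum>i\<in>UNIV. \<Sum>j\<in>UNIV.
      (a i p * b j p) * differential M (H i j) p v
      + (a i p * differential M (b j) p v + differential M (a i) p v * b j p) * H i j p)"
    by (rule differentialI)
      (intro has_derivative_sum
        has_derivative_eq_rhs[OF has_derivative_mult[OF has_derivative_mult[OF dd[OF a] dd[OF b]] dd[OF H]]],
        simp add: cp)
  finally have 1: "differential M (\<lambda>q. h (\<psi> q) (W q) (W' q)) p v = (\<Sum>i\<in>UNIV. \<Sum>j\<in>UNIV.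
      (a i p * b j p) * differential M (H i j) p v
      + (a i p * differential M (b j) p v + differential M (a i) p v * b j p) * H i j p)" by simp
  \<comment> \<open>The chain rule moves the derivative to \<open>N\<close>, in direction
    \<open>dv\<close>, where metric compatibility of \<open>nabla\<close> applies.\<close>
  have 2: "differential M (H i j) p v = h (\<psi> p) (nabla (E i) (\<psi> p) dv) (E j (\<psi> p))
      + h (\<psi> p) (E i (\<psi> p)) (nabla (E j) (\<psi> p) dv)" for i j
    using differential_tangent_map[OF M N \<psi> V hE pM d(2), of i j v] comp V E d(2)
    unfolding H_def[abs_def] dv_def metric_compatible_def by simp
  have W1: "W p = (\<Sum>i\<in>UNIV. a i p *\<^sub>R E i (\<psi> p))" and W2: "W' p = (\<Sum>i\<in>UNIV. b i p *\<^sub>R E i (\<psi> p))"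
    unfolding a_def b_def E_def using coord_field_expansion[OF N d] by simp_all
  have D1: "D W p v = (\<Sum>i\<in>UNIV. differential M (a i) p v *\<^sub>R E i (\<psi> p) + a i p *\<^sub>R nabla (E i) (\<psi> p) dv)"
    and D2: "D W' p v = (\<Sum>i\<in>UNIV. differential M (b i) p v *\<^sub>R E i (\<psi> p) + b i p *\<^sub>R nabla (E i) (\<psi> p) dv)"
    using induced_connection_coord[OF U W p d] induced_connection_coord[OF U W' p d]
    unfolding a_def[abs_def] b_def[abs_def] E_def dv_def by simp_all
  note B = bil[OF pN]
  show "differential M (\<lambda>q. h (\<psi> q) (W q) (W' q)) p v
      = h (\<psi> p) (D W p v) (W' p) + h (\<psi> p) (W p) (D W' p v)"
    unfolding 1 2 D1 D2 unfolding W1 W2 bilinear_sum_sum[OF B] sum.distrib[symmetric]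
    by (intro sum.cong refl)
      (simp add: bilinear_ladd[OF B] bilinear_radd[OF B] bilinear_lmul[OF B] bilinear_rmul[OF B]
        H_def algebra_simps)
qed

text \<open>A rearranged form of the symmetry of the second fundamental form. In coordinates the
  Christoffel terms of \<open>N\<close> are symmetric in \<open>X\<close> and \<open>Z\<close> and
  cancel; the second derivatives of the components of \<open>\<psi>\<close> that remain form the
  bracket on \<open>M\<close>.\<close>

lemma induced_connection_torsion_free:
  assumes nabla: "affine_connection N nabla" "torsion_free N nabla" and nablaM: "torsion_free M nablaM"
    and U: "openin (mtop M) U" and p: "p \<in> U"
    and X: "smooth_vector_field M U X" and Z: "smooth_vector_field M U Z"
  shows "D (\<lambda>q. tangent_map M N \<psi> q (Z q)) p (X p) - D (\<lambda>q. tangent_map M N \<psi> q (X q)) p (Z p)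
    = tangent_map M N \<psi> p (nablaM Z p (X p) - nablaM X p (Z p))"
proof -
  have pM: "p \<in> points M" and pN: "\<psi> p \<in> points N"
    using \<psi> p openin_subset[OF U] by (auto simp: smooth_map_def continuous_map_def)
  define d where "d = chart_at N (\<psi> p)"
  have d: "d \<in> atlas N" "\<psi> p \<in> fst d" using chart_at_in[OF N pN] by (auto simp: d_def)
  note V = smooth_manifold_chartD(1)[OF N d(1)]
  let ?U = "U \<inter> \<psi> -` fst d"
  define E where "E i = coord_field N d (axis i 1)" for i
  define f where "f i q = snd d (\<psi> q) $ i" for i q
  let ?T = "tangent_map M N \<psi>"
  have o: "openin (mtop M) ?U" by (rule openin_section_domain[OF N \<psi> U d(1)])
  have pU: "p \<in> ?U" using p d by auto
  note ch = smooth_vfun_chart_map[OF M N \<psi> d(1), of U]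
  have f: "smooth_vfun M ?U (f i)" for i
    unfolding f_def[abs_def]
    by (rule smooth_vfun_compose[OF M o ch
          smooth_on_bounded_linear[OF bounded_linear_vec_nth, of UNIV]]) auto
  have co: "differential N (snd d) (\<psi> q) (?T q v) $ i = differential M (f i) q v"
    if "q \<in> ?U" for q v i
    using that differential_chart_tangent_map[OF M N \<psi> d(1), of q v] openin_subset[OF U]
      differential_vec_nth[OF smooth_vfun_differentiable[OF M o ch that], of i v]
    unfolding f_def[abs_def] by auto
  have T: "?T p v = (\<Sum>i\<in>UNIV. differential M (f i) p v *\<^sub>R E i (\<psi> p))" for v
    using coord_field_expansion[OF N d, of "?T p v"] co[OF pU] by (simp add: E_def)
  have lin: "linear (nabla (E i) (\<psi> p))" for i
    unfolding E_def
    by (rule connection_linear[OF nabla(1) V smooth_coord_field[OF N d(1)] d(2)])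
  have D: "D (\<lambda>q. ?T q (Z q)) p v
      = (\<Sum>i\<in>UNIV. differential M (\<lambda>q. differential M (f i) q (Z q)) p v *\<^sub>R E i (\<psi> p))
        + (\<Sum>i\<in>UNIV. \<Sum>k\<in>UNIV. (differential M (f i) p (Z p) * differential M (f k) p v)
            *\<^sub>R nabla (E i) (\<psi> p) (E k (\<psi> p)))"
    if Z: "smooth_vector_field M U Z" for Z v
  proof -
    have "differential M (\<lambda>q. differential N (snd d) (\<psi> q) (?T q (Z q)) $ i) p
        = differential M (\<lambda>q. differential M (f i) q (Z q)) p" for i
      by (rule differential_cong(1)[OF M o pU co])
    then show ?thesis
      using induced_connection_coord[OF U smooth_section_tangent_map[OF M N \<psi> U Z] p d, of v] co[OF pU]
      by (simp add: E_def[symmetric] T[of v] linear_sum[OF lin] linear_scale[OF lin]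
          scaleR_sum_right sum.distrib)
  qed
  have com: "nabla (E i) (\<psi> p) (E k (\<psi> p)) = nabla (E k) (\<psi> p) (E i (\<psi> p))" for i k
    unfolding E_def by (rule coord_field_commute[OF N nabla(2) d])
  \<comment> \<open>Renaming the two indices exchanges \<open>X\<close> and \<open>Z\<close>, at no
    cost by the symmetry \<open>com\<close>.\<close>
  have "(\<Sum>i\<in>UNIV. \<Sum>k\<in>UNIV. (differential M (f i) p (X p) * differential M (f k) p (Z p))
            *\<^sub>R nabla (E i) (\<psi> p) (E k (\<psi> p)))
      = (\<Sum>i\<in>UNIV. \<Sum>k\<in>UNIV. (differential M (f i) p (Z p) * differential M (f k) p (X p))
            *\<^sub>R nabla (E i) (\<psi> p) (E k (\<psi> p)))"
    by (subst sum.swap) (intro sum.cong refl, simp add: com mult.commute)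
  moreover have "differential M (\<lambda>q. differential M (f i) q (Z q)) p (X p)
      - differential M (\<lambda>q. differential M (f i) q (X q)) p (Z p)
      = differential M (f i) p (nablaM Z p (X p) - nablaM X p (Z p))" for i
    using nablaM[unfolded torsion_free_def smooth_fun_iff, rule_format, OF o
        smooth_section_subset[OF X Int_lower1] smooth_section_subset[OF Z Int_lower1] f pU]
    by simp
  ultimately show ?thesis
    unfolding D[OF X] D[OF Z] T
    by (simp add: sum_subtractf[symmetric] scaleR_left_diff_distrib[symmetric])
qed

end


section \<open>Orthonormal frames\<close>

text \<open>Pairing with \<open>e j\<close> recovers the j-th coefficient, so forming combinations
  is injective. The type indexing the frame also gives the dimension, hence the map is
  surjective.\<close>

lemma orthonormal_expansion:
  fixes e :: "'m::finite \<Rightarrow> real ^ 'm"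
  assumes B: "bilinear B" and e: "\<And>i j. B (e i) (e j) = (if i = j then 1 else (0::real))"
  shows "v = (\<Sum>i\<in>UNIV. B v (e i) *\<^sub>R e i)"
proof -
  let ?T = "\<lambda>a :: real ^ 'm. \<Sum>i\<in>UNIV. (a $ i) *\<^sub>R e i"
  have lin: "linear ?T"
    by (rule linearI) (simp_all add: scaleR_add_left sum.distrib scaleR_sum_right)
  have l: "linear (\<lambda>x. B x y)" for y using B by (auto simp: bilinear_def)
  have co: "B (?T a) (e j) = a $ j" for a j
    by (simp add: linear_sum[OF l] linear_scale[OF l] e if_distrib cong: if_cong)
  have "inj ?T" by (rule injI) (metis co vec_eq_iff)
  with lin have "surj ?T" by (rule linear_inj_imp_surj)
  then obtain a where "v = ?T a" by blast
  then show ?thesis using co by simp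
qed

text \<open>Expanding \<open>e'\<close> in \<open>e\<close> produces the coefficients
  \<open>B (e' i) (e j) * B (e' i) (e k)\<close>, whose sum over \<open>i\<close> is
  \<open>B (e j) (e k)\<close> by Parseval.\<close>

lemma orthonormal_trace_unique:
  fixes e e' :: "'m::finite \<Rightarrow> real ^ 'm" and Q :: "real ^ 'm \<Rightarrow> real ^ 'm \<Rightarrow> real"
  assumes B: "bilinear B" and sym: "\<And>u v. B u v = B v u" and Q: "bilinear Q"
    and e: "\<And>i j. B (e i) (e j) = (if i = j then 1 else (0::real))"
    and e': "\<And>i j. B (e' i) (e' j) = (if i = j then 1 else (0::real))"
  shows "(\<Sum>i\<in>UNIV. Q (e' i) (e' i)) = (\<Sum>i\<in>UNIV. Q (e i) (e i))"
proof -
  have l: "linear (\<lambda>x. B x y)" for y using B by (auto simp: bilinear_def)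
  have parseval: "(\<Sum>i\<in>UNIV. B (e' i) u * B (e' i) v) = B u v" for u v
  proof -
    have "B u v = B (\<Sum>i\<in>UNIV. B u (e' i) *\<^sub>R e' i) v"
      using orthonormal_expansion[OF B e', of u] by simp
    then show ?thesis by (simp add: linear_sum[OF l] linear_scale[OF l] sym[of u])
  qed
  have "Q (e' i) (e' i) = (\<Sum>j\<in>UNIV. \<Sum>k\<in>UNIV. B (e' i) (e j) * B (e' i) (e k) * Q (e j) (e k))"
    for i
  proof -
    have "Q (e' i) (e' i)
        = Q (\<Sum>j\<in>UNIV. B (e' i) (e j) *\<^sub>R e j) (\<Sum>k\<in>UNIV. B (e' i) (e k) *\<^sub>R e k)"
      using orthonormal_expansion[OF B e, of "e' i"] by simp
    then show ?thesis
      by (simp only: bilinear_sum_sum[OF Q] bilinear_lmul[OF Q] bilinear_rmul[OF Q])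
        (simp add: mult_ac)
  qed
  then have "(\<Sum>i\<in>UNIV. Q (e' i) (e' i))
      = (\<Sum>i\<in>UNIV. \<Sum>j\<in>UNIV. \<Sum>k\<in>UNIV. B (e' i) (e j) * B (e' i) (e k) * Q (e j) (e k))"
    by simp
  also have "\<dots> = (\<Sum>j\<in>UNIV. \<Sum>i\<in>UNIV. \<Sum>k\<in>UNIV. B (e' i) (e j) * B (e' i) (e k) * Q (e j) (e k))"
    by (rule sum.swap)
  also have "\<dots> = (\<Sum>j\<in>UNIV. \<Sum>k\<in>UNIV. \<Sum>i\<in>UNIV. B (e' i) (e j) * B (e' i) (e k) * Q (e j) (e k))"
    by (rule sum.cong[OF refl], rule sum.swap)
  also have "\<dots> = (\<Sum>j\<in>UNIV. \<Sum>k\<in>UNIV. B (e j) (e k) * Q (e j) (e k))"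
    by (simp add: parseval sum_distrib_right[symmetric])
  also have "\<dots> = (\<Sum>i\<in>UNIV. Q (e i) (e i))"
    by (simp add: e if_distrib[of "\<lambda>x. x * _"] cong: if_cong)
  finally show ?thesis .
qed

text \<open>Gram-Schmidt as an induction over the index set, in any order of insertion, with the
  neighbourhood shrinking at each step.\<close>

lemma partial_orthonormal_frame:
  fixes M :: "('a, 'm::finite) mfd" and J :: "'m set"
  assumes rm: "riemannian_manifold M g" and p: "p \<in> points M"
  shows "\<exists>U e. openin (mtop M) U \<and> p \<in> U \<and> (\<forall>i\<in>J. smooth_vector_field M U (e i)) \<and>
    (\<forall>q\<in>U. \<forall>i\<in>J. \<forall>j\<in>J. g q (e i q) (e j q) = (if i = j then 1 else 0))"
  using finite[of J]
proof (induction J rule: finite_induct)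
  case empty
  show ?case using p by (intro exI[of _ "points M"]) auto
next
  case (insert k J)
  have M: "smooth_manifold M" and g: "riemannian_metric M g"
    using rm by (auto simp: riemannian_manifold_def)
  from insert.IH obtain U e where U: "openin (mtop M) U" "p \<in> U"
    and e: "\<And>i. i \<in> J \<Longrightarrow> smooth_vector_field M U (e i)"
    and orth: "\<And>q i j. q \<in> U \<Longrightarrow> i \<in> J \<Longrightarrow> j \<in> J \<Longrightarrow> g q (e i q) (e j q) = (if i = j then 1 else 0)"
    by blast
  \<comment> \<open>Fewer vectors than the dimension cannot span, which supplies a new direction
    \<open>v\<close> at \<open>p\<close>.\<close>
  have "card ((\<lambda>i. e i p) ` J) \<le> card J" by (simp add: card_image_le)
  also have "card J < CARD('m)"
    using insert.hyps by (intro psubset_card_mono) auto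
  finally have "dim (span ((\<lambda>i. e i p) ` J)) < CARD('m)"
    using dim_le_card'[of "(\<lambda>i. e i p) ` J"] by (simp add: dim_span)
  then have "span ((\<lambda>i. e i p) ` J) \<noteq> UNIV"
    by (metis dim_UNIV DIM_cart DIM_real mult.right_neutral less_irrefl)
  then obtain v where v: "v \<notin> span ((\<lambda>i. e i p) ` J)" by blast
  define d where "d = chart_at M p"
  have d: "d \<in> atlas M" "p \<in> fst d" using chart_at_in[OF M p] by (auto simp: d_def)
  \<comment> \<open>Constant components in a chart extend \<open>v\<close> to a smooth
    field.\<close>
  define V where "V = coord_field M d (differential M (snd d) p v)"
  have Vp: "V p = v" by (simp add: V_def coord_field_differential[OF M d])
  let ?U1 = "U \<inter> fst d"
  have U1: "openin (mtop M) ?U1" using U smooth_manifold_chartD(1)[OF M d(1)] by blast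
  have V: "smooth_vector_field M ?U1 V"
    unfolding V_def by (rule smooth_section_subset[OF smooth_coord_field[OF M d(1)]]) auto
  have e1: "smooth_vector_field M ?U1 (e i)" if "i \<in> J" for i
    by (rule smooth_section_subset[OF e[OF that]]) auto
  have gs: "smooth_vfun M ?U1 (\<lambda>q. g q (X q) (Y q))"
    if "smooth_vector_field M ?U1 X" "smooth_vector_field M ?U1 Y" for X Y
    using g that U1 unfolding riemannian_metric_def smooth_fun_iff by blast
  \<comment> \<open>Subtraction of the projection, written with the factor -1 so that the closure
    rules for sums and products suffice.\<close>
  define W where "W q = V q + (\<Sum>i\<in>J. ((-1) * g q (V q) (e i q)) *\<^sub>R e i q)" for q
  note idM = smooth_map_id[OF M]
  have W: "smooth_vector_field M ?U1 W"
    unfolding W_def[abs_def]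
    by (intro smooth_section_add[OF M M idM U1] smooth_section_sum[OF M M idM U1]
        smooth_section_scaleR[OF M M idM U1] smooth_vfun_mult[OF M U1] smooth_vfun_const gs V e1)
  define n where "n q = g q (W q) (W q)" for q
  have n: "smooth_vfun M ?U1 n" unfolding n_def[abs_def] by (rule gs[OF W W])
  define U2 where "U2 = {q \<in> ?U1. 0 < n q}"
  have U2: "openin (mtop M) U2" unfolding U2_def by (rule openin_pos_smooth_vfun[OF M U1 n])
  have sub: "U2 \<subseteq> ?U1" by (auto simp: U2_def)
  have "W p \<noteq> 0"
  proof
    assume "W p = 0"
    then have "v = (\<Sum>i\<in>J. g p v (e i p) *\<^sub>R e i p)"
      by (simp add: W_def Vp sum_negf)
    also have "\<dots> \<in> span ((\<lambda>i. e i p) ` J)"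
      by (intro span_sum span_scale span_base) auto
    finally show False using v by simp
  qed
  then have pU2: "p \<in> U2"
    using g p U d by (auto simp: U2_def n_def riemannian_metric_def)
  \<comment> \<open>Division by the length; as a power of the squared length \<open>n\<close> it is
    smooth where \<open>n\<close> is positive.\<close>
  define w where "w q = (n q powr (-1/2)) *\<^sub>R W q" for q
  have w: "smooth_vector_field M U2 w"
    unfolding w_def[abs_def]
    by (intro smooth_section_scaleR[OF M M idM U2] smooth_section_subset[OF W sub]
        smooth_vfun_compose[OF M U2 smooth_vfun_subset[OF n sub] smooth_on_powr])
      (auto simp: U2_def)
  let ?e = "e(k := w)"
  have "g q (?e i q) (?e j q) = (if i = j then 1 else 0)"
    if q: "q \<in> U2" and ij: "i \<in> insert k J" "j \<in> insert k J" for q i j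
  proof -
    have qU: "q \<in> U" and "q \<in> points M" using q sub openin_subset[OF U(1)] by auto
    then have B: "bilinear (g q)" and sym: "\<And>u v. g q u v = g q v u"
      using g by (auto simp: riemannian_metric_def)
    have l: "linear (\<lambda>x. g q x y)" for y using B by (auto simp: bilinear_def)
    have "g q (W q) (e j q) = 0" if j: "j \<in> J" for j
    proof -
      have "g q (W q) (e j q) = g q (V q) (e j q)
          - (\<Sum>i\<in>J. g q (V q) (e i q) * g q (e i q) (e j q))"
        by (simp add: W_def linear_add[OF l] linear_sum[OF l] linear_diff[OF l] linear_scale[OF l]
            sum_negf)
      also have "(\<Sum>i\<in>J. g q (V q) (e i q) * g q (e i q) (e j q))
          = (\<Sum>i\<in>J. if i = j then g q (V q) (e i q) else 0)"
        by (rule sum.cong) (use orth[OF qU] j in auto)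
      finally show ?thesis using j insert.hyps by simp
    qed
    then have wj: "g q (w q) (e j q) = 0" if "j \<in> J" for j
      using that by (simp add: w_def bilinear_lmul[OF B])
    have "n q > 0" using q by (simp add: U2_def)
    then have "n q powr (-1/2) * (n q powr (-1/2) * n q) = 1"
      by (simp add: powr_minus powr_half_sqrt field_simps)
    then have ww: "g q (w q) (w q) = 1"
      by (simp add: w_def bilinear_lmul[OF B] bilinear_rmul[OF B] n_def)
    show ?thesis using ij wj ww orth[OF qU, of i j] insert.hyps sym[of "e i q" "w q"] by auto
  qed
  moreover have "smooth_vector_field M U2 (?e i)" if "i \<in> insert k J" for i
    using that w smooth_section_subset[OF e1 sub] by auto
  ultimately show ?case using U2 pU2 by (intro exI[of _ U2] exI[of _ ?e]) blast
qed

text \<open>Existence is what gives the choice in \<open>frame_at\<close> a meaning.\<close>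

lemma frame_at_orthonormal:
  assumes "riemannian_manifold M g" "p \<in> points M"
  shows "\<exists>U. p \<in> U \<and> local_orthonormal_frame M g U (frame_at M g p)"
proof -
  have "\<exists>e U. p \<in> U \<and> local_orthonormal_frame M g U e"
    using partial_orthonormal_frame[OF assms, of UNIV]
    unfolding local_orthonormal_frame_def ball_UNIV by blast
  then show ?thesis unfolding frame_at_def by (rule someI_ex)
qed

text \<open>Also justifies the definite description in \<open>gradient\<close>: the frame expression
  represents the differential, and for any other candidate the difference would have length
  zero.\<close>

lemma gradient_frame:
  fixes M :: "('a, 'm::finite) mfd" and e :: "'m \<Rightarrow> real ^ 'm"
  assumes g: "riemannian_metric M g" and p: "p \<in> points M" and f: "differentiable_at_mfd M f p"
    and e: "\<And>i j. g p (e i) (e j) = (if i = j then 1 else 0)"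
  shows "gradient M g f p = (\<Sum>i\<in>UNIV. differential M f p (e i) *\<^sub>R e i)"
proof -
  have B: "bilinear (g p)" and pos: "\<And>v. v \<noteq> 0 \<Longrightarrow> g p v v > 0"
    using g p by (auto simp: riemannian_metric_def)
  have l: "linear (\<lambda>x. g p x y)" for y using B by (auto simp: bilinear_def)
  note lf = linear_differential[OF f]
  show ?thesis unfolding gradient_def
  proof (rule the_equality)
    show *: "\<forall>v. g p (\<Sum>i\<in>UNIV. differential M f p (e i) *\<^sub>R e i) v = differential M f p v"
    proof
      fix v
      have sym: "g p u v = g p v u" for u using g p by (simp add: riemannian_metric_def)
      have "g p (\<Sum>i\<in>UNIV. differential M f p (e i) *\<^sub>R e i) v
          = (\<Sum>i\<in>UNIV. g p v (e i) * differential M f p (e i))"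
        by (simp only: linear_sum[OF l] linear_scale[OF l]) (simp add: sym[of "e _"] mult.commute)
      also have "\<dots> = differential M f p (\<Sum>i\<in>UNIV. g p v (e i) *\<^sub>R e i)"
        by (simp add: linear_sum[OF lf] linear_scale[OF lf])
      also have "\<dots> = differential M f p v"
        using orthonormal_expansion[OF B e, of v] by simp
      finally show "g p (\<Sum>i\<in>UNIV. differential M f p (e i) *\<^sub>R e i) v = differential M f p v" .
    qed
    fix w assume w: "\<forall>v. g p w v = differential M f p v"
    let ?s = "\<Sum>i\<in>UNIV. differential M f p (e i) *\<^sub>R e i"
    have "g p (w - ?s) (w - ?s) = 0" using w * linear_diff[OF l] by simp
    then show "w = ?s" using pos[of "w - ?s"] by force
  qed
qed


section \<open>The divergence of the stress-energy tensor\<close>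

lemma differential_compose_real:
  assumes M: "smooth_manifold M" and p: "p \<in> points M" and f: "differentiable_at_mfd M f p"
    and F: "(F has_real_derivative F') (at (f p))"
  shows "differentiable_at_mfd M (\<lambda>q. F (f q)) p"
    and "differential M (\<lambda>q. F (f q)) p v = differential M f p v * F'"
proof -
  have "cinv (chart_at M p) (snd (chart_at M p) p) = p"
    using cinv_chart[OF M chart_at_in[OF M p]] .
  then have *: "((\<lambda>x. F (f (cinv (chart_at M p) x))) has_derivative
      (\<lambda>v. differential M f p v * F')) (at (snd (chart_at M p) p))"
    using DERIV_compose_FDERIV[OF _ differentiable_has_derivative[OF f]] F by simp
  then show "differentiable_at_mfd M (\<lambda>q. F (f q)) p"
    by (auto simp: differentiable_at_mfd_def o_def differentiable_def)
  show "differential M (\<lambda>q. F (f q)) p v = differential M f p v * F'"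
    using differentialI[of "\<lambda>q. F (f q)", OF *] by simp
qed

lemma differential_mult:
  fixes f f' :: "'a \<Rightarrow> real"
  assumes M: "smooth_manifold M" and p: "p \<in> points M"
    and f: "differentiable_at_mfd M f p" "differentiable_at_mfd M f' p"
  shows "differentiable_at_mfd M (\<lambda>q. f q * f' q) p"
    and "differential M (\<lambda>q. f q * f' q) p v = f p * differential M f' p v + differential M f p v * f' p"
proof -
  have "cinv (chart_at M p) (snd (chart_at M p) p) = p"
    using cinv_chart[OF M chart_at_in[OF M p]] .
  then have *: "((\<lambda>x. f (cinv (chart_at M p) x) * f' (cinv (chart_at M p) x)) has_derivative
      (\<lambda>v. f p * differential M f' p v + differential M f p v * f' p)) (at (snd (chart_at M p) p))"
    using has_derivative_mult[OF f[THEN differentiable_has_derivative]] by simp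
  then show "differentiable_at_mfd M (\<lambda>q. f q * f' q) p"
    by (auto simp: differentiable_at_mfd_def o_def differentiable_def)
  show "differential M (\<lambda>q. f q * f' q) p v = f p * differential M f' p v + differential M f p v * f' p"
    using differentialI[of "\<lambda>q. f q * f' q", OF *] by simp
qed

lemma differential_diff:
  assumes "differentiable_at_mfd M f p" "differentiable_at_mfd M f' p"
  shows "differential M (\<lambda>q. f q - f' q) p v = differential M f p v - differential M f' p v"
  using differentialI[of "\<lambda>q. f q - f' q",
      OF has_derivative_diff[OF assms[THEN differentiable_has_derivative]]] by simp

lemma differential_sum:
  assumes "\<And>i. i \<in> I \<Longrightarrow> differentiable_at_mfd M (f i) p"
  shows "differentiable_at_mfd M (\<lambda>q. \<Sum>i\<in>I. f i q) p"
    and "differential M (\<lambda>q. \<Sum>i\<in>I. f i q) p v = (\<Sum>i\<in>I. differential M (f i) p v)"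
proof -
  have *: "((\<lambda>x. \<Sum>i\<in>I. f i (cinv (chart_at M p) x)) has_derivative
      (\<lambda>v. \<Sum>i\<in>I. differential M (f i) p v)) (at (snd (chart_at M p) p))"
    using assms by (intro has_derivative_sum differentiable_has_derivative)
  then show "differentiable_at_mfd M (\<lambda>q. \<Sum>i\<in>I. f i q) p"
    by (auto simp: differentiable_at_mfd_def o_def differentiable_def)
  show "differential M (\<lambda>q. \<Sum>i\<in>I. f i q) p v = (\<Sum>i\<in>I. differential M (f i) p v)"
    using differentialI[of "\<lambda>q. \<Sum>i\<in>I. f i q", OF *] by simp
qed

text \<open>Replaces the frame that \<open>hs_norm\<close> selects at \<open>q\<close> by an
  arbitrary one, so that a single frame field serves a whole neighbourhood. Nonnegativity of
  \<open>h\<close> is what undoes the square root.\<close>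

lemma hs_norm_frame:
  fixes M :: "('a, 'm::finite) mfd" and N :: "('b, 'n::finite) mfd" and e :: "'m \<Rightarrow> real ^ 'm"
  assumes M: "riemannian_manifold M g" and N: "riemannian_manifold N h" and \<psi>: "smooth_map M N \<psi>"
    and q: "q \<in> points M" and e: "\<And>i j. g q (e i) (e j) = (if i = j then 1 else 0)"
  shows "(hs_norm M g N h \<psi> q)\<^sup>2
    = (\<Sum>i\<in>UNIV. h (\<psi> q) (tangent_map M N \<psi> q (e i)) (tangent_map M N \<psi> q (e i)))"
proof -
  have qN: "\<psi> q \<in> points N" using \<psi> q by (auto simp: smooth_map_def continuous_map_def)
  have sM: "smooth_manifold M" and sN: "smooth_manifold N"
    using M N by (auto simp: riemannian_manifold_def)
  have g: "bilinear (g q)" "\<And>u v. g q u v = g q v u"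
    using M q by (auto simp: riemannian_manifold_def riemannian_metric_def)
  have h: "bilinear (h (\<psi> q))" and pos: "\<And>v. v \<noteq> 0 \<Longrightarrow> h (\<psi> q) v v > 0"
    using N qN by (auto simp: riemannian_manifold_def riemannian_metric_def)
  note T = linear_tangent_map[OF sM sN \<psi> q]
  have Q: "bilinear (\<lambda>u v. h (\<psi> q) (tangent_map M N \<psi> q u) (tangent_map M N \<psi> q v))"
    using h linear_compose[OF T] unfolding bilinear_def o_def by blast
  obtain U where "q \<in> U" "local_orthonormal_frame M g U (frame_at M g q)"
    using frame_at_orthonormal[OF M q] by blast
  then have e': "g q (frame_at M g q i q) (frame_at M g q j q) = (if i = j then 1 else 0)" for i j
    unfolding local_orthonormal_frame_def by blast
  have "h (\<psi> q) v v \<ge> 0" for v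
    using pos[of v] bilinear_lzero[OF h] by (cases "v = 0") (auto simp: less_imp_le)
  then show ?thesis
    unfolding orthonormal_trace_unique[OF g Q e e', symmetric] hs_norm_def Let_def
    by (intro real_sqrt_pow2 sum_nonneg)
qed

text \<open>The matrix \<open>g(\<nabla>\<^sub>v e\<^sub>i, e\<^sub>j)\<close> is antisymmetric.\<close>

lemma sum_frame_derivative_zero:
  fixes M :: "('a, 'm::finite) mfd" and Q :: "real ^ 'm \<Rightarrow> real ^ 'm \<Rightarrow> real"
  assumes M: "smooth_manifold M" and g: "riemannian_metric M g" and comp: "metric_compatible M g nabla"
    and e: "local_orthonormal_frame M g U e" and p: "p \<in> U"
    and Q: "bilinear Q" and sym: "\<And>u v. Q u v = Q v u"
  shows "(\<Sum>i\<in>UNIV. Q (e i p) (nabla (e i) p v)) = 0"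
proof -
  have U: "openin (mtop M) U" and es: "\<And>i. smooth_vector_field M U (e i)"
    and orth: "\<And>q i j. q \<in> U \<Longrightarrow> g q (e i q) (e j q) = (if i = j then 1 else 0)"
    using e unfolding local_orthonormal_frame_def by blast+
  have pM: "p \<in> points M" using openin_subset[OF U] p by auto
  have B: "bilinear (g p)" and gsym: "\<And>u v. g p u v = g p v u"
    using g pM by (auto simp: riemannian_metric_def)
  define c where "c i j = g p (nabla (e i) p v) (e j p)" for i j
  define K where "K i j = Q (e i p) (e j p)" for i j
  \<comment> \<open>Differentiate the constant function \<open>g (e i) (e j)\<close>.\<close>
  have anti: "c i j = - c j i" for i j
  proof -
    have "differential M (\<lambda>q. g q (e i q) (e j q)) p v
        = g p (nabla (e i) p v) (e j p) + g p (e i p) (nabla (e j) p v)"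
      using comp U es p unfolding metric_compatible_def by blast
    moreover have "differential M (\<lambda>q. g q (e i q) (e j q)) p = differential M (\<lambda>q. if i = j then 1 else 0) p"
      by (rule differential_cong(1)[OF M U p orth])
    ultimately have "g p (nabla (e i) p v) (e j p) + g p (e i p) (nabla (e j) p v) = 0"
      by (simp only: differential_const)
    then show ?thesis using gsym[of "e i p" "nabla (e j) p v"] by (simp add: c_def)
  qed
  \<comment> \<open>An antisymmetric matrix paired with a symmetric one: the double sum equals its
    own negative.\<close>
  have "c i j * K i j = - (c j i * K j i)" for i j
    using anti[of i j] sym[of "e i p" "e j p"] by (simp add: K_def)
  then have "(\<Sum>i\<in>UNIV. \<Sum>j\<in>UNIV. c i j * K i j) = (\<Sum>i\<in>UNIV. \<Sum>j\<in>UNIV. - (c j i * K j i))"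
    by (intro sum.cong refl)
  also have "\<dots> = - (\<Sum>i\<in>UNIV. \<Sum>j\<in>UNIV. c i j * K i j)"
    by (subst sum.swap) (simp add: sum_negf)
  finally have 0: "(\<Sum>i\<in>UNIV. \<Sum>j\<in>UNIV. c i j * K i j) = 0" by simp
  have lQ: "linear (Q u)" for u using Q by (auto simp: bilinear_def)
  have "Q (e i p) (nabla (e i) p v) = (\<Sum>j\<in>UNIV. c i j * K i j)" for i
  proof -
    have "Q (e i p) (nabla (e i) p v) = Q (e i p) (\<Sum>j\<in>UNIV. c i j *\<^sub>R e j p)"
      using orthonormal_expansion[OF B orth[OF p], of "nabla (e i) p v"] by (simp add: c_def)
    then show ?thesis by (simp add: linear_sum[OF lQ] linear_scale[OF lQ] K_def)
  qed
  with 0 show ?thesis by simp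
qed

theorem proposition6:
  fixes \<alpha> :: real
    and M :: "('a, 'm::finite) mfd" and g :: "('a, 'm) tensor2"
    and N :: "('b, 'n::finite) mfd" and h :: "('b, 'n) tensor2"
    and \<psi> :: "'a \<Rightarrow> 'b"
    and nablaM :: "('a, 'm, 'm) conn" and nablaN :: "('b, 'n, 'n) conn"
    and D :: "('a, 'm, 'n) conn"
    and Y :: "'a \<Rightarrow> real ^ 'm"
  assumes "\<alpha> > 1"
    and "riemannian_manifold M g" and "compact_space (mtop M)"
    and "riemannian_manifold N h"
    and "smooth_map M N \<psi>"
    and "levi_civita M g nablaM" and "levi_civita N h nablaN"
    and "induced_connection M N \<psi> nablaN D"
    and "smooth_vector_field M (points M) Y"
  shows "\<forall>p\<in>points M.
    divergence M g nablaM (alpha_stress_energy \<alpha> M g N h \<psi>) Y p =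
    - h (\<psi> p) (alpha_tension \<alpha> M g N h nablaM D \<psi> p) (tangent_map M N \<psi> p (Y p))"
proof
  fix p assume p: "p \<in> points M"
  note \<psi> = assms(5) and ind = assms(8)
  have M: "smooth_manifold M" and g: "riemannian_metric M g"
    and N: "smooth_manifold N" and h: "riemannian_metric N h"
    using assms by (auto simp: riemannian_manifold_def)
  have affM: "affine_connection M nablaM" and torM: "torsion_free M nablaM"
    and metM: "metric_compatible M g nablaM"
    and affN: "affine_connection N nablaN" and torN: "torsion_free N nablaN"
    and metN: "metric_compatible N h nablaN"
    using assms by (auto simp: levi_civita_def)
  have pN: "\<psi> p \<in> points N" using \<psi> p by (auto simp: smooth_map_def continuous_map_def)
  have Bg: "bilinear (g p)" and gsym: "\<And>u v. g p u v = g p v u"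
    using g p by (auto simp: riemannian_metric_def)
  have Bh: "bilinear (h (\<psi> p))" and hsym: "\<And>u v. h (\<psi> p) u v = h (\<psi> p) v u"
    using h pN by (auto simp: riemannian_metric_def)
  have lh: "linear (\<lambda>u. h (\<psi> p) u v)" for v using Bh by (auto simp: bilinear_def)
  let ?T = "tangent_map M N \<psi>"
  note T = linear_tangent_map[OF M N \<psi> p]
  define e where "e = frame_at M g p"
  obtain U where pU: "p \<in> U" and frame: "local_orthonormal_frame M g U e"
    using frame_at_orthonormal[OF assms(2) p] unfolding e_def by blast
  then have U: "openin (mtop M) U" and es: "\<And>i. smooth_vector_field M U (e i)"
    and orth: "\<And>q i j. q \<in> U \<Longrightarrow> g q (e i q) (e j q) = (if i = j then 1 else 0)"
    unfolding local_orthonormal_frame_def by blast+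
  have Y: "smooth_vector_field M U Y"
    by (rule smooth_section_subset[OF assms(9) openin_subset[OF U]])
  define F where "F q = (hs_norm M g N h \<psi> q)\<^sup>2" for q
  define f where "f q = (1 + F q) powr \<alpha>" for q
  define w where "w q = 2 * \<alpha> * (1 + F q) powr (\<alpha> - 1)" for q
  define A where "A i q = ?T q (e i q)" for i q
  define B where "B q = ?T q (Y q)" for q
  have A: "smooth_section M N \<psi> U (A i)" for i
    unfolding A_def[abs_def] by (rule smooth_section_tangent_map[OF M N \<psi> U es])
  have B: "smooth_section M N \<psi> U B"
    unfolding B_def[abs_def] by (rule smooth_section_tangent_map[OF M N \<psi> U Y])
  note met = induced_connection_metric[OF M N \<psi> ind h metN U pU]
  \<comment> \<open>One frame on all of \<open>U\<close>, although \<open>hs_norm\<close> selects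
    its own at each \<open>q\<close>; otherwise \<open>F\<close> could not be differentiated term by
    term.\<close>
  have Feq: "F q = (\<Sum>i\<in>UNIV. h (\<psi> q) (A i q) (A i q))" if "q \<in> U" for q
    unfolding F_def A_def
    by (rule hs_norm_frame[OF assms(2,4) \<psi> _ orth[OF that]])
      (use that openin_subset[OF U] in blast)
  have dF: "differentiable_at_mfd M F p"
    using differential_sum(1)[of UNIV M "\<lambda>i q. h (\<psi> q) (A i q) (A i q)" p] met(1)[OF A A]
      differential_cong(2)[OF M U pU Feq] by simp
  have F': "differential M F p v = 2 * (\<Sum>i\<in>UNIV. h (\<psi> p) (A i p) (D (A i) p v))" for v
  proof -
    have "differential M F p v = (\<Sum>i\<in>UNIV. differential M (\<lambda>q. h (\<psi> q) (A i q) (A i q)) p v)"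
      using differential_sum(2)[of UNIV M "\<lambda>i q. h (\<psi> q) (A i q) (A i q)" p v] met(1)[OF A A]
        differential_cong(1)[OF M U pU Feq] by simp
    also have "\<dots> = (\<Sum>i\<in>UNIV. 2 * h (\<psi> p) (A i p) (D (A i) p v))"
      by (intro sum.cong refl) (simp add: met(2)[OF A A] hsym[of "D _ _ _"])
    finally show ?thesis by (simp add: sum_distrib_left)
  qed
  \<comment> \<open>\<open>F\<close> is a square, so the base of both powers is positive and
    \<open>powr\<close> is differentiable there.\<close>
  have F0: "1 + F p > 0" unfolding F_def by (simp add: add_pos_nonneg)
  have f1: "((\<lambda>y. (1 + y) powr \<alpha>) has_real_derivative \<alpha> * (1 + F p) powr (\<alpha> - 1)) (at (F p))"
    using F0 by (auto intro!: derivative_eq_intros)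
  \<comment> \<open>Only differentiability of \<open>w\<close> is drawn from this; its differential
    stays symbolic and ends up in \<open>gradient M g w\<close>.\<close>
  have w1: "((\<lambda>y. 2 * \<alpha> * (1 + y) powr (\<alpha> - 1)) has_real_derivative
      2 * \<alpha> * ((\<alpha> - 1) * (1 + F p) powr (\<alpha> - 1 - 1))) (at (F p))"
    using F0 by (auto intro!: derivative_eq_intros)
  have df: "differentiable_at_mfd M f p" and dw: "differentiable_at_mfd M w p"
    using differential_compose_real(1)[OF M p dF f1] differential_compose_real(1)[OF M p dF w1]
    by (simp_all add: f_def[abs_def] w_def[abs_def])
  have f': "differential M f p v = w p * (\<Sum>i\<in>UNIV. h (\<psi> p) (A i p) (D (A i) p v))" for v
    using differential_compose_real(2)[OF M p dF f1, of v]
    by (simp add: f_def[abs_def] w_def F')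
  define t where "t i = cov_deriv_tangent_map M N nablaM D \<psi> (e i) (e i) p" for i
  \<comment> \<open>Solved for the derivative of \<open>A i\<close>, so that the correction term
    meets its counterpart in \<open>cov_deriv2\<close>.\<close>
  have t: "D (A i) p (e i p) = t i + ?T p (nablaM (e i) p (e i p))" for i
    by (simp add: t_def cov_deriv_tangent_map_def A_def[abs_def])
  \<comment> \<open>Symmetry of the second fundamental form exchanges the roles of
    \<open>e i\<close> and \<open>Y\<close>, turning a derivative of \<open>B\<close> into one of
    \<open>A i\<close>, which also occurs in \<open>f'\<close>.\<close>
  have tor: "D B p (e i p) = D (A i) p (Y p) + ?T p (nablaM Y p (e i p)) - ?T p (nablaM (e i) p (Y p))"
    for i
  proof -
    have "(\<lambda>q. ?T q (e i q)) = A i" "(\<lambda>q. ?T q (Y q)) = B" by (auto simp: A_def B_def)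
    then show ?thesis
      using induced_connection_torsion_free[OF M N \<psi> ind affN torN torM U pU es Y, of i]
      by (simp add: linear_diff[OF T] algebra_simps)
  qed
  \<comment> \<open>All undifferentiated \<open>f\<close> terms cancel because \<open>g\<close> is
    parallel. Among the \<open>w\<close> terms, those with \<open>nablaM (e i) p (e i p)\<close> and
    \<open>nablaM Y p (e i p)\<close> cancel, and only the derivative of \<open>e i\<close> along
    \<open>Y\<close> survives.\<close>
  have summand: "cov_deriv2 M nablaM (alpha_stress_energy \<alpha> M g N h \<psi>) (e i) (e i) Y p
      = differential M f p (e i p) * g p (Y p) (e i p)
        - differential M w p (e i p) * h (\<psi> p) (A i p) (B p)
        - w p * h (\<psi> p) (t i) (B p)
        - w p * h (\<psi> p) (A i p) (D (A i) p (Y p))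
        + w p * h (\<psi> p) (?T p (e i p)) (?T p (nablaM (e i) p (Y p)))" for i
  proof -
    let ?G = "\<lambda>q. g q (e i q) (Y q)" and ?H = "\<lambda>q. h (\<psi> q) (A i q) (B q)" and ?v = "e i p"
    have "smooth_vfun M U ?G"
      using g U es Y unfolding riemannian_metric_def smooth_fun_iff by blast
    then have dG: "differentiable_at_mfd M ?G p" by (rule smooth_vfun_differentiable[OF M U _ pU])
    have G': "differential M ?G p ?v = g p (nablaM (e i) p ?v) (Y p) + g p ?v (nablaM Y p ?v)"
      using metM U es Y pU unfolding metric_compatible_def by blast
    have S: "alpha_stress_energy \<alpha> M g N h \<psi> q u v = f q * g q u v - w q * h (\<psi> q) (?T q u) (?T q v)"
      for q u v by (simp add: alpha_stress_energy_def f_def w_def F_def)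
    have dS: "differential M (\<lambda>q. alpha_stress_energy \<alpha> M g N h \<psi> q (e i q) (Y q)) p ?v
        = f p * differential M ?G p ?v + differential M f p ?v * ?G p
          - (w p * differential M ?H p ?v + differential M w p ?v * ?H p)"
      unfolding S A_def[symmetric] B_def[symmetric]
      by (simp only: differential_diff[OF differential_mult(1)[OF M p df dG]
            differential_mult(1)[OF M p dw met(1)[OF A B]]]
          differential_mult(2)[OF M p df dG] differential_mult(2)[OF M p dw met(1)[OF A B]])
    have DB: "h (\<psi> p) (A i p) (D B p ?v) = h (\<psi> p) (A i p) (D (A i) p (Y p))
        + h (\<psi> p) (A i p) (?T p (nablaM Y p ?v)) - h (\<psi> p) (A i p) (?T p (nablaM (e i) p (Y p)))"
      by (simp add: tor bilinear_radd[OF Bh] bilinear_rsub[OF Bh])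
    show ?thesis
      unfolding cov_deriv2_def dS G' met(2)[OF A B]
      unfolding S t bilinear_ladd[OF Bh] A_def[symmetric] B_def[symmetric] DB gsym[of "Y p"]
      by (simp add: algebra_simps)
  qed
  \<comment> \<open>The left side is \<open>differential M f p (Y p)\<close> expanded in the frame;
    in this form it cancels the sum of the fourth terms of \<open>summand\<close>.\<close>
  have sum_f: "(\<Sum>i\<in>UNIV. differential M f p (e i p) * g p (Y p) (e i p))
      = w p * (\<Sum>i\<in>UNIV. h (\<psi> p) (A i p) (D (A i) p (Y p)))"
  proof -
    note l = linear_differential[OF df]
    have "(\<Sum>i\<in>UNIV. differential M f p (e i p) * g p (Y p) (e i p))
        = differential M f p (\<Sum>i\<in>UNIV. g p (Y p) (e i p) *\<^sub>R e i p)"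
      by (simp add: linear_sum[OF l] linear_scale[OF l] mult.commute)
    also have "\<dots> = differential M f p (Y p)"
      using orthonormal_expansion[OF Bg orth[OF pU], of "Y p"] by simp
    finally show ?thesis by (simp only: f')
  qed
  have sum_w: "(\<Sum>i\<in>UNIV. differential M w p (e i p) * h (\<psi> p) (A i p) (B p))
      = h (\<psi> p) (?T p (gradient M g w p)) (B p)"
    unfolding gradient_frame[OF g p dw orth[OF pU]]
    by (simp add: linear_sum[OF T] linear_scale[OF T] linear_sum[OF lh] linear_scale[OF lh] A_def)
  \<comment> \<open>The surviving frame derivatives vanish in total, since the pulled-back form is
    bilinear and symmetric.\<close>
  have sum_0: "(\<Sum>i\<in>UNIV. h (\<psi> p) (?T p (e i p)) (?T p (nablaM (e i) p (Y p)))) = 0"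
  proof (rule sum_frame_derivative_zero[OF M g metM frame pU])
    show "bilinear (\<lambda>u v. h (\<psi> p) (?T p u) (?T p v))"
      using Bh linear_compose[OF T] unfolding bilinear_def o_def by blast
  qed (rule hsym)
  have "divergence M g nablaM (alpha_stress_energy \<alpha> M g N h \<psi>) Y p
      = - h (\<psi> p) (?T p (gradient M g w p)) (B p) - w p * (\<Sum>i\<in>UNIV. h (\<psi> p) (t i) (B p))"
    unfolding divergence_def Let_def e_def[symmetric] summand sum.distrib sum_subtractf sum_f sum_w
      sum_distrib_left[symmetric] sum_0 by simp
  also have "\<dots> = - h (\<psi> p) (w p *\<^sub>R (\<Sum>i\<in>UNIV. t i) + ?T p (gradient M g w p)) (B p)"
    by (simp add: bilinear_ladd[OF Bh] bilinear_lmul[OF Bh] linear_sum[OF lh])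
  also have "w p *\<^sub>R (\<Sum>i\<in>UNIV. t i) + ?T p (gradient M g w p)
      = alpha_tension \<alpha> M g N h nablaM D \<psi> p"
    by (simp add: alpha_tension_def tension_def Let_def t_def e_def w_def[abs_def] F_def)
  finally show "divergence M g nablaM (alpha_stress_energy \<alpha> M g N h \<psi>) Y p
      = - h (\<psi> p) (alpha_tension \<alpha> M g N h nablaM D \<psi> p) (?T p (Y p))"
    by (simp only: B_def)
qed

end
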